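(* Let $0<\tau\le T$, let $X$ be a real continuous finite quadratic variation process with $X_0=0$ a.s., and let $f:\mathbb R^2\to\mathbb R$ be of class $C^2$. Then $$\begin{aligned}\int_{-\tau}^0f(X_{x+T},X_{T-\tau})\,dx={}&\tau f(0,0)+\int_0^T\Big(\int_y^{(y+\tau)\wedge T}\partial_1f(X_y,X_{t-\tau})\,dt\Big)d^-X_y\\&+\int_0^{T-\tau}\Big(\int_{-\tau}^0\partial_2f(X_{y+x+\tau},X_y)\,dx\Big)d^-X_y\\&+\frac12\int_0^{T-\tau}\Big(\int_{-\tau}^0\partial^2_{2\,2}f(X_{y+z+\tau},X_y)\,dz\Big)d[X]_y\\&+\frac12\int_{-\tau}^0\Big(\int_{-x}^T\partial^2_{1\,1}f(X_{t+x},X_{t-\tau})\,[X]_{dt+x}\Big)dx,\end{aligned}$$ provided that at least one of the two forward integrals above exists.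
   Context: Fix $T>0$ and a probability space $(\Omega,\mathcal F,\mathbb P)$. Processes on $[0,T]$ are extended by $X_t=X_0$ for $t\le0$ and $X_t=X_T$ for $t\ge T$. $X$ has finite quadratic variation if $\frac1\epsilon\int_0^t(X_{s+\epsilon}-X_s)^2ds$ converges in probability as $\epsilon\to0$ for every $t\in[0,T]$ and the limit admits a continuous version, denoted $[X]$. For a process $Y$ with a.s. integrable paths, the forward integral $\int_0^tY_yd^-X_y$ (here $t=T$ or $t=T-\tau$) is the limit in probability as $\epsilon\to0$ of $\int_0^tY_y\frac{X_{y+\epsilon}-X_y}{\epsilon}dy$, whenever it exists; the integrand need not be adapted. $[X]_{dt+x}$ is the Stieltjes measure of the increasing function $t\mapsto[X]_{t+x}$. $\partial_i$, $\partial^2_{ij}$ denote partial derivatives with respect to the $i$-th (and $j$-th) variables of $f$. *)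

theory Defs
  imports "HOL-Probability.Probability"
begin

text \<open>
  Processes are curried with time first: \<open>X t \<omega>\<close>. Only the values for \<open>0 \<le> t \<le> T\<close> matter;
  outside, a process is extended by \<open>X\<^sub>0\<close> on the left and by \<open>X\<^sub>T\<close> on the right.
\<close>

definition extend :: "real \<Rightarrow> (real \<Rightarrow> 'a \<Rightarrow> real) \<Rightarrow> real \<Rightarrow> 'a \<Rightarrow> real" where
  "extend T X t = X (max 0 (min t T))"

definition continuous_process :: "'a measure \<Rightarrow> real \<Rightarrow> (real \<Rightarrow> 'a \<Rightarrow> real) \<Rightarrow> bool" where
  "continuous_process M T X \<longleftrightarrow>
     (\<forall>t\<in>{0..T}. X t \<in> borel_measurable M) \<and>
     (AE \<omega> in M. continuous_on {0..T} (\<lambda>t. X t \<omega>))"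

text \<open>
  Convergence in probability of a family of random variables along a filter. Paths are continuous
  or integrable only almost surely, so pathwise integrals are measurable only up to null sets:
  the approximating variables are measured in the completion of \<open>M\<close>. The explicit
  measurability requirement matters because \<open>measure\<close> is 0 on nonmeasurable sets.
\<close>

definition tendsto_in_prob ::
  "'a measure \<Rightarrow> ('b \<Rightarrow> 'a \<Rightarrow> real) \<Rightarrow> ('a \<Rightarrow> real) \<Rightarrow> 'b filter \<Rightarrow> bool" where
  "tendsto_in_prob M Z L F \<longleftrightarrow>
     L \<in> borel_measurable M \<and>
     (\<forall>\<^sub>F \<epsilon> in F. Z \<epsilon> \<in> borel_measurable (completion M)) \<and>
     (\<forall>\<delta>>0. ((\<lambda>\<epsilon>. measure (completion M) {\<omega> \<in> space M. \<bar>Z \<epsilon> \<omega> - L \<omega>\<bar> > \<delta>}) \<longlongrightarrow> 0) F)"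

text \<open>
  \<open>quadratic_variation M T X Q\<close>: the process \<open>X\<close> has finite quadratic variation on \<open>[0,T]\<close> and
  \<open>Q\<close> is a continuous version of the limit, i.e. \<open>Q = [X]\<close>. Limits in probability are unique only
  up to null sets, so \<open>Q\<close> is unique up to indistinguishability and this is a relation.
  As usual in regularization, \<open>\<epsilon>\<close> tends to 0 through positive values.
\<close>

definition quadratic_variation ::
  "'a measure \<Rightarrow> real \<Rightarrow> (real \<Rightarrow> 'a \<Rightarrow> real) \<Rightarrow> (real \<Rightarrow> 'a \<Rightarrow> real) \<Rightarrow> bool" where
  "quadratic_variation M T X Q \<longleftrightarrow>
     continuous_process M T Q \<and>
     (\<forall>t\<in>{0..T}. tendsto_in_prob M
        (\<lambda>\<epsilon> \<omega>. 1 / \<epsilon> * (LBINT s:{0..t}. (extend T X (s + \<epsilon>) \<omega> - extend T X s \<omega>)\<^sup>2))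
        (Q t) (at_right 0))"

text \<open>
  \<open>forward_integral M T X Y t I\<close>: the forward integral of \<open>Y\<close> against \<open>X\<close> over \<open>[0,t]\<close> exists and
  equals (a.s.) the random variable \<open>I\<close>. \<open>X\<close> is not stopped at \<open>t\<close>: for \<open>t < T\<close> the increments
  look beyond \<open>t\<close>.
\<close>

definition forward_integral ::
  "'a measure \<Rightarrow> real \<Rightarrow> (real \<Rightarrow> 'a \<Rightarrow> real) \<Rightarrow> (real \<Rightarrow> 'a \<Rightarrow> real) \<Rightarrow> real \<Rightarrow> ('a \<Rightarrow> real) \<Rightarrow> bool"
  where
  "forward_integral M T X Y t I \<longleftrightarrow>
     (AE \<omega> in M. set_integrable lborel {0..t} (\<lambda>y. Y y \<omega>)) \<and>
     tendsto_in_prob M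
       (\<lambda>\<epsilon> \<omega>. LBINT y:{0..t}. Y y \<omega> * ((extend T X (y + \<epsilon>) \<omega> - extend T X y \<omega>) / \<epsilon>))
       I (at_right 0)"

definition partial1 :: "(real \<times> real \<Rightarrow> real) \<Rightarrow> real \<times> real \<Rightarrow> real" (\<open>\<partial>\<^sub>1\<close>) where
  "\<partial>\<^sub>1 f p = deriv (\<lambda>a. f (a, snd p)) (fst p)"

definition partial2 :: "(real \<times> real \<Rightarrow> real) \<Rightarrow> real \<times> real \<Rightarrow> real" (\<open>\<partial>\<^sub>2\<close>) where
  "\<partial>\<^sub>2 f p = deriv (\<lambda>b. f (fst p, b)) (snd p)"

definition C1 :: "(real \<times> real \<Rightarrow> real) \<Rightarrow> bool" where
  "C1 f \<longleftrightarrow>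
     (\<forall>a b. (\<lambda>u. f (u, b)) differentiable (at a) \<and> (\<lambda>v. f (a, v)) differentiable (at b)) \<and>
     continuous_on UNIV (\<partial>\<^sub>1 f) \<and> continuous_on UNIV (\<partial>\<^sub>2 f)"

definition C2 :: "(real \<times> real \<Rightarrow> real) \<Rightarrow> bool" where
  "C2 f \<longleftrightarrow> C1 f \<and> C1 (\<partial>\<^sub>1 f) \<and> C1 (\<partial>\<^sub>2 f)"

end

theory Submission
  imports Defs "HOL-Library.Diagonal_Subsequence"
begin

text \<open>
  Write \<open>w\<close> for one path of \<open>X\<close>, extended by constants, and put
  \<open>U t = u t (w (t - \<tau>))\<close> with \<open>u t b = \<integral>\<^bsub>[t - \<tau>, t]\<^esub> f (w s, b) ds\<close>. Then \<open>U T\<close> is the left-hand side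
  of the formula and \<open>U 0 = \<tau> f (0, 0)\<close>, so the formula is an Ito expansion of \<open>U\<close>. By the
  fundamental theorem of calculus \<open>1/\<epsilon> \<integral>\<^bsub>[0, T]\<^esub> (U (t + \<epsilon>) - U t) dt\<close> tends to \<open>U T - U 0\<close>. The increment
  of \<open>U\<close> is split into
  \<open>[u (t + \<epsilon>) b - u t b] + [u (t + \<epsilon>) b' - u (t + \<epsilon>) b]\<close>, where \<open>b = w (t - \<tau>)\<close> and
  \<open>b' = w (t - \<tau> + \<epsilon>)\<close>.

  In the first bracket the increment falls on the first argument of \<open>f\<close>. Fubini on the strip
  \<open>s \<le> t \<le> s + \<tau>\<close> turns its integral into an integral over \<open>s\<close>, and a second order Taylor
  expansion in that argument produces the first forward sum and the term with the second
  derivative in the first variable. In the second bracket \<open>u (t + \<epsilon>)\<close> may be replaced by \<open>u t\<close>: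
  both integrate the same small function \<open>f (\<cdot>, b') - f (\<cdot>, b)\<close>, over windows that differ by two
  intervals of length \<open>\<epsilon>\<close>, so the replacement costs only \<open>o(\<epsilon>)\<close>. This is why no mixed derivative and
  no covariation between \<open>X\<close> and its delayed copy appears: integrating over the window makes \<open>u t b\<close>
  continuously differentiable in \<open>t\<close> for each fixed \<open>b\<close>. A Taylor expansion in the second
  argument then gives the other forward sum and the other second order term
  (\<open>window_integral_increment\<close>, \<open>forward_expansion_tendsto\<close>, \<open>forward_sums_tendsto\<close>).

  The Taylor terms of second order integrate continuous functions against the measures
  \<open>(w (s + \<epsilon>) - w s)\<^sup>2 / \<epsilon> ds\<close>. Their distribution functions converge to that of \<open>d[X]\<close>, hence so do
  the integrals (\<open>integral_square_increments_tendsto\<close>).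

  All of this is deterministic: it holds for every continuous path and every sequence \<open>\<epsilon>\<^sub>n \<rightarrow> 0\<close> along which the
  distribution functions converge, on a countable dense set of times, to a continuous limit. Convergence in probability
  supplies almost sure convergence of the latter along a subsequence of any given sequence. The
  sum of the two forward approximations therefore converges in probability
  (\<open>tendsto_in_prob_pathwiseI\<close>), so one of them converges if and only if the other does, and the limits
  add up to the claimed expression.
\<close>

section \<open>Convergence in probability through almost sure subsequences\<close>

text \<open>
  The Ky Fan type distance whose convergence to 0 is convergence in probability. It replaces a
  family of limits indexed by \<open>\<delta>\<close> by a single one that obeys a triangle inequality.
\<close>

definition prob_dist :: "'a measure \<Rightarrow> ('a \<Rightarrow> real) \<Rightarrow> ('a \<Rightarrow> real) \<Rightarrow> real" where
  "prob_dist M Z L = (\<integral>\<omega>. min 1 \<bar>Z \<omega> - L \<omega>\<bar> \<partial>completion M)"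

lemma integrable_min_one_abs:
  assumes "prob_space M"
    and [measurable]: "Z \<in> borel_measurable (completion M)" "L \<in> borel_measurable (completion M)"
  shows "integrable (completion M) (\<lambda>\<omega>. min 1 \<bar>Z \<omega> - L \<omega> :: real\<bar>)"
proof -
  interpret N: prob_space "completion M" by (rule prob_space.prob_space_completion[OF assms(1)])
  show ?thesis by (rule N.integrable_const_bound[where B=1]) auto
qed

lemma prob_dist_nonneg: "0 \<le> prob_dist M Z L"
  unfolding prob_dist_def by (intro integral_nonneg_AE) auto

lemma deviation_sets:
  fixes Z L :: "'a \<Rightarrow> real"
  assumes [measurable]: "Z \<in> borel_measurable (completion M)" "L \<in> borel_measurable (completion M)"
  shows "{\<omega> \<in> space M. \<bar>Z \<omega> - L \<omega>\<bar> > \<delta>} \<in> sets (completion M)"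
proof -
  have "{\<omega> \<in> space (completion M). \<bar>Z \<omega> - L \<omega>\<bar> > \<delta>} \<in> sets (completion M)"
    by measurable
  then show ?thesis by simp
qed

text \<open>
  Markov's inequality and its counterpart: the integrand is at most \<open>\<delta>\<close> off the event of a deviation and at
  most 1 on it.
\<close>

lemma prob_dist_deviation:
  assumes M: "prob_space M" and \<delta>: "0 < \<delta>" "\<delta> \<le> 1"
    and [measurable]: "Z \<in> borel_measurable (completion M)" "L \<in> borel_measurable (completion M)"
  defines "P \<equiv> measure (completion M) {\<omega> \<in> space M. \<bar>Z \<omega> - L \<omega>\<bar> > \<delta>}"
  shows "\<delta> * P \<le> prob_dist M Z L" "prob_dist M Z L \<le> \<delta> + P"
proof -
  interpret N: prob_space "completion M" by (rule prob_space.prob_space_completion[OF M])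
  let ?A = "{\<omega> \<in> space M. \<bar>Z \<omega> - L \<omega>\<bar> > \<delta>}"
  have A [measurable]: "?A \<in> sets (completion M)"
    by (rule deviation_sets) auto
  have A': "?A \<inter> space M = ?A" by auto
  have iA: "integrable (completion M) (indicator ?A :: 'a \<Rightarrow> real)"
    using A by (intro integrable_real_indicator) (auto simp: N.emeasure_eq_measure)
  have "\<delta> * P = (\<integral>\<omega>. \<delta> * indicator ?A \<omega> \<partial>completion M)"
    unfolding P_def by (simp add: A')
  also have "\<dots> \<le> prob_dist M Z L"
    unfolding prob_dist_def
    using \<delta> by (intro integral_mono integrable_min_one_abs[OF M] integrable_mult_right iA)
       (auto simp: indicator_def)
  finally show "\<delta> * P \<le> prob_dist M Z L" .
  have "prob_dist M Z L \<le> (\<integral>\<omega>. \<delta> + indicator ?A \<omega> \<partial>completion M)"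
    unfolding prob_dist_def
    using \<delta> by (intro integral_mono integrable_min_one_abs[OF M] Bochner_Integration.integrable_add iA)
       (auto simp: indicator_def)
  also have "\<dots> = \<delta> + P"
    unfolding P_def using \<delta>
    by (subst Bochner_Integration.integral_add)
       (auto simp: N.prob_space[simplified] A' iA)
  finally show "prob_dist M Z L \<le> \<delta> + P" .
qed

lemma tendsto_in_prob_iff_prob_dist:
  assumes M: "prob_space M"
  shows "tendsto_in_prob M Z L F \<longleftrightarrow>
    L \<in> borel_measurable M \<and> (\<forall>\<^sub>F \<epsilon> in F. Z \<epsilon> \<in> borel_measurable (completion M)) \<and>
    ((\<lambda>\<epsilon>. prob_dist M (Z \<epsilon>) L) \<longlongrightarrow> 0) F"
proof -
  interpret N: prob_space "completion M" by (rule prob_space.prob_space_completion[OF M])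
  let ?P = "\<lambda>\<delta> \<epsilon>. measure (completion M) {\<omega> \<in> space M. \<bar>Z \<epsilon> \<omega> - L \<omega>\<bar> > \<delta>}"
  have "((\<lambda>\<epsilon>. prob_dist M (Z \<epsilon>) L) \<longlongrightarrow> 0) F \<longleftrightarrow> (\<forall>\<delta>>0. (?P \<delta> \<longlongrightarrow> 0) F)"
    if L: "L \<in> borel_measurable M" and Z: "\<forall>\<^sub>F \<epsilon> in F. Z \<epsilon> \<in> borel_measurable (completion M)"
  proof safe
    have L': "L \<in> borel_measurable (completion M)" using L by (rule measurable_completion)
    {
      fix \<delta> :: real assume lim: "((\<lambda>\<epsilon>. prob_dist M (Z \<epsilon>) L) \<longlongrightarrow> 0) F" and "\<delta> > 0"
      \<comment> \<open>The distance is truncated at 1, so deviations are compared with a threshold of at most 1.\<close>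
      define c where "c = min \<delta> 1"
      have c: "0 < c" "c \<le> 1" "c \<le> \<delta>" using \<open>\<delta> > 0\<close> by (auto simp: c_def)
      have "\<forall>\<^sub>F \<epsilon> in F. ?P \<delta> \<epsilon> \<le> prob_dist M (Z \<epsilon>) L / c"
        using Z
      proof eventually_elim
        case (elim \<epsilon>)
        have "?P \<delta> \<epsilon> \<le> ?P c \<epsilon>"
          using c by (intro N.finite_measure_mono deviation_sets elim L') auto
        also have "\<dots> \<le> prob_dist M (Z \<epsilon>) L / c"
          using prob_dist_deviation(1)[OF M c(1,2) elim L'] c by (simp add: field_simps)
        finally show ?case .
      qed
      moreover have "((\<lambda>\<epsilon>. prob_dist M (Z \<epsilon>) L / c) \<longlongrightarrow> 0) F"
        using tendsto_divide[OF lim tendsto_const[of c]] c by simp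
      ultimately show "(?P \<delta> \<longlongrightarrow> 0) F"
        by (rule tendsto_sandwich[OF _ _ tendsto_const, rotated]) auto
    }
    assume lim: "\<forall>\<delta>>0. (?P \<delta> \<longlongrightarrow> 0) F"
    show "((\<lambda>\<epsilon>. prob_dist M (Z \<epsilon>) L) \<longlongrightarrow> 0) F"
    proof (rule tendstoI)
      fix e :: real assume "0 < e"
      define c where "c = min (e/2) 1"
      have c: "0 < c" "c \<le> 1" "c \<le> e/2" using \<open>e > 0\<close> by (auto simp: c_def)
      have "(?P c \<longlongrightarrow> 0) F" using lim c by auto
      then have "\<forall>\<^sub>F \<epsilon> in F. ?P c \<epsilon> < c" using c by (intro order_tendstoD(2))
      with Z show "\<forall>\<^sub>F \<epsilon> in F. dist (prob_dist M (Z \<epsilon>) L) 0 < e"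
      proof eventually_elim
        case (elim \<epsilon>)
        then show ?case
          using prob_dist_deviation(2)[OF M c(1,2) elim(1) L'] c prob_dist_nonneg[of M "Z \<epsilon>" L]
          by (simp add: dist_real_def)
      qed
    qed
  qed
  then show ?thesis unfolding tendsto_in_prob_def by blast
qed

text \<open>
  The hypothesis is stated for six functions instead of three so that the lemma covers sums and
  differences of convergent families as well as the uniqueness of limits.
\<close>

lemma prob_dist_triangle:
  assumes M: "prob_space M"
    and [measurable]: "Z \<in> borel_measurable (completion M)" "L \<in> borel_measurable (completion M)"
       "U \<in> borel_measurable (completion M)" "V \<in> borel_measurable (completion M)"
       "Y \<in> borel_measurable (completion M)" "K \<in> borel_measurable (completion M)"
    and le: "AE \<omega> in completion M. \<bar>U \<omega> - V \<omega>\<bar> \<le> \<bar>Z \<omega> - L \<omega>\<bar> + \<bar>Y \<omega> - K \<omega>\<bar>"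
  shows "prob_dist M U V \<le> prob_dist M Z L + prob_dist M Y K"
proof -
  note int = integrable_min_one_abs[OF M]
  have "prob_dist M U V \<le> (\<integral>\<omega>. min 1 \<bar>Z \<omega> - L \<omega>\<bar> + min 1 \<bar>Y \<omega> - K \<omega>\<bar> \<partial>completion M)"
    unfolding prob_dist_def
  proof (intro integral_mono_AE int Bochner_Integration.integrable_add)
    show "AE \<omega> in completion M. min 1 \<bar>U \<omega> - V \<omega>\<bar> \<le> min 1 \<bar>Z \<omega> - L \<omega>\<bar> + min 1 \<bar>Y \<omega> - K \<omega>\<bar>"
      using le by eventually_elim auto
  qed auto
  also have "\<dots> = prob_dist M Z L + prob_dist M Y K"
    unfolding prob_dist_def by (intro Bochner_Integration.integral_add int) auto
  finally show ?thesis .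
qed

text \<open>
  If a sum and one of its summands converge in probability, so does the other summand. This
  transfers the existence of one forward integral to the other.
\<close>

lemma tendsto_in_prob_diff:
  assumes M: "prob_space M"
    and S: "tendsto_in_prob M S J F" and Z: "tendsto_in_prob M Z I F"
    and Y: "\<forall>\<^sub>F \<epsilon> in F. Y \<epsilon> \<in> borel_measurable (completion M)"
    and eq: "\<forall>\<^sub>F \<epsilon> in F. AE \<omega> in M. S \<epsilon> \<omega> = Z \<epsilon> \<omega> + Y \<epsilon> \<omega>"
  shows "tendsto_in_prob M Y (\<lambda>\<omega>. J \<omega> - I \<omega>) F"
proof -
  note [simp] = tendsto_in_prob_iff_prob_dist[OF M]
  have I: "I \<in> borel_measurable M" and J: "J \<in> borel_measurable M" using S Z by auto
  have Zm: "\<forall>\<^sub>F \<epsilon> in F. Z \<epsilon> \<in> borel_measurable (completion M)"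
    and Sm: "\<forall>\<^sub>F \<epsilon> in F. S \<epsilon> \<in> borel_measurable (completion M)" using S Z by auto
  have "\<forall>\<^sub>F \<epsilon> in F. prob_dist M (Y \<epsilon>) (\<lambda>\<omega>. J \<omega> - I \<omega>) \<le> prob_dist M (S \<epsilon>) J + prob_dist M (Z \<epsilon>) I"
    using Zm Sm Y eq
  proof eventually_elim
    case (elim \<epsilon>)
    show ?case
    proof (rule prob_dist_triangle[OF M])
      show "AE \<omega> in completion M. \<bar>Y \<epsilon> \<omega> - (J \<omega> - I \<omega>)\<bar> \<le> \<bar>S \<epsilon> \<omega> - J \<omega>\<bar> + \<bar>Z \<epsilon> \<omega> - I \<omega>\<bar>"
        using elim(4) unfolding AE_completion_iff by eventually_elim auto
    qed (use elim I J in \<open>auto intro: measurable_completion\<close>)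
  qed
  moreover have "((\<lambda>\<epsilon>. prob_dist M (S \<epsilon>) J + prob_dist M (Z \<epsilon>) I) \<longlongrightarrow> 0) F"
    using S Z by (intro tendsto_add_zero) auto
  ultimately have "((\<lambda>\<epsilon>. prob_dist M (Y \<epsilon>) (\<lambda>\<omega>. J \<omega> - I \<omega>)) \<longlongrightarrow> 0) F"
    by (rule tendsto_sandwich[OF always_eventually[OF allI[OF prob_dist_nonneg]] _ tendsto_const])
  then show ?thesis using I J Y by auto
qed

lemma tendsto_in_prob_unique:
  assumes M: "prob_space M" and F: "F \<noteq> bot"
    and S: "tendsto_in_prob M S J F" and Z: "tendsto_in_prob M S I F"
  shows "AE \<omega> in M. J \<omega> = I \<omega>"
proof -
  have I: "I \<in> borel_measurable (completion M)" "J \<in> borel_measurable (completion M)"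
    using S Z by (auto simp: tendsto_in_prob_def intro: measurable_completion)
  have "\<forall>\<^sub>F \<epsilon> in F. prob_dist M J I \<le> prob_dist M (S \<epsilon>) J + prob_dist M (S \<epsilon>) I"
    using S unfolding tendsto_in_prob_def
    by (auto elim!: eventually_mono intro!: prob_dist_triangle[OF M] I)
  moreover have "((\<lambda>\<epsilon>. prob_dist M (S \<epsilon>) J + prob_dist M (S \<epsilon>) I) \<longlongrightarrow> 0 + 0) F"
    using S Z by (intro tendsto_add) (auto simp: tendsto_in_prob_iff_prob_dist[OF M])
  ultimately have "prob_dist M J I \<le> 0"
    using tendsto_lowerbound F by fastforce
  then have "(\<integral>\<omega>. min 1 \<bar>J \<omega> - I \<omega>\<bar> \<partial>completion M) = 0"
    using prob_dist_nonneg[of M J I] unfolding prob_dist_def by linarith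
  then have "AE \<omega> in completion M. min 1 \<bar>J \<omega> - I \<omega>\<bar> = 0"
    by (subst (asm) integral_nonneg_eq_0_iff_AE) (auto intro!: integrable_min_one_abs[OF M] I)
  then show ?thesis
    unfolding AE_completion_iff by eventually_elim (auto simp: min_def split: if_splits)
qed

lemma tendsto_in_prob_AE_subseq:
  assumes M: "prob_space M" and Z: "tendsto_in_prob M Z L F" and e: "filterlim e F sequentially"
  shows "\<exists>r::nat\<Rightarrow>nat. strict_mono r \<and> (AE \<omega> in M. (\<lambda>n. Z (e (r n)) \<omega>) \<longlonglongrightarrow> L \<omega>)"
proof -
  have "\<forall>\<^sub>F n in sequentially. Z (e n) \<in> borel_measurable (completion M)"
    using eventually_compose_filterlim[OF _ e] Z by (auto simp: tendsto_in_prob_def)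
  then obtain m where m: "Z (e n) \<in> borel_measurable (completion M)" if "n \<ge> m" for n
    by (auto simp: eventually_sequentially)
  have L: "L \<in> borel_measurable (completion M)"
    using Z by (auto simp: tendsto_in_prob_def intro: measurable_completion)
  let ?u = "\<lambda>n \<omega>. min 1 \<bar>Z (e (n + m)) \<omega> - L \<omega>\<bar>"
  have "(\<lambda>n. prob_dist M (Z (e n)) L) \<longlonglongrightarrow> 0"
    using filterlim_compose[OF _ e] Z by (auto simp: tendsto_in_prob_iff_prob_dist[OF M])
  from LIMSEQ_ignore_initial_segment[OF this, of m]
  have "(\<lambda>n. \<integral>\<omega>. norm (?u n \<omega>) \<partial>completion M) \<longlonglongrightarrow> 0"
    by (simp add: prob_dist_def)
  moreover have "integrable (completion M) (?u n)" for n
    by (intro integrable_min_one_abs[OF M] m L) auto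
  ultimately obtain r where r: "strict_mono r" "AE \<omega> in completion M. (\<lambda>n. ?u (r n) \<omega>) \<longlonglongrightarrow> 0"
    using tendsto_L1_AE_subseq[of "completion M" ?u] by auto
  have "AE \<omega> in M. (\<lambda>n. Z (e (r n + m)) \<omega>) \<longlonglongrightarrow> L \<omega>"
    using r(2) unfolding AE_completion_iff
  proof eventually_elim
    case (elim \<omega>)
    then have "\<forall>\<^sub>F n in sequentially. ?u (r n) \<omega> < 1" by (rule order_tendstoD) auto
    then have "\<forall>\<^sub>F n in sequentially. ?u (r n) \<omega> = \<bar>Z (e (r n + m)) \<omega> - L \<omega>\<bar>"
      by eventually_elim auto
    with elim have "(\<lambda>n. \<bar>Z (e (r n + m)) \<omega> - L \<omega>\<bar>) \<longlonglongrightarrow> 0"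
      by (rule Lim_transform_eventually)
    then show ?case by (simp add: tendsto_rabs_zero_iff LIM_zero_iff)
  qed
  moreover have "strict_mono (\<lambda>n. r n + m)" using r(1) by (simp add: strict_mono_def)
  ultimately show ?thesis by blast
qed

lemma tendsto_in_prob_AE_subseq_countable:
  fixes S :: "'i \<Rightarrow> 'b \<Rightarrow> 'a \<Rightarrow> real" and e :: "nat \<Rightarrow> 'b"
  assumes M: "prob_space M" and D: "countable D"
    and S: "\<And>t. t \<in> D \<Longrightarrow> tendsto_in_prob M (S t) (Q t) F" and e: "filterlim e F sequentially"
  shows "\<exists>r::nat\<Rightarrow>nat. strict_mono r \<and> (AE \<omega> in M. \<forall>t\<in>D. (\<lambda>n. S t (e (r n)) \<omega>) \<longlonglongrightarrow> Q t \<omega>)"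
proof (cases "D = {}")
  case True
  then show ?thesis by (auto intro!: exI[of _ id] simp: strict_mono_def)
next
  case False
  define t where "t = from_nat_into D"
  have t: "t k \<in> D" for k using from_nat_into[OF False] by (simp add: t_def)
  define P where "P k r \<longleftrightarrow> (AE \<omega> in M. (\<lambda>n. S (t k) (e (r n)) \<omega>) \<longlonglongrightarrow> Q (t k) \<omega>)" for k r
  interpret subseqs P
  proof
    fix k and s :: "nat \<Rightarrow> nat" assume "strict_mono s"
    then have "filterlim (e \<circ> s) F sequentially"
      unfolding comp_def by (intro filterlim_compose[OF e] filterlim_subseq)
    from tendsto_in_prob_AE_subseq[OF M S[OF t] this]
    show "\<exists>r'. strict_mono r' \<and> P k (s \<circ> r')" by (auto simp: P_def)
  qed
  have "P k (diagseq \<circ> (+) (Suc k))" for k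
  proof (rule diagseq_holds)
    fix r s k assume r: "strict_mono (r::nat\<Rightarrow>nat)" and P: "P k s"
    from P show "P k (s \<circ> r)"
      unfolding P_def by eventually_elim (use r in \<open>auto dest: LIMSEQ_subseq_LIMSEQ simp: comp_def\<close>)
  qed
  then have "AE \<omega> in M. (\<lambda>n. S (t k) (e (diagseq (Suc k + n))) \<omega>) \<longlonglongrightarrow> Q (t k) \<omega>" for k
    by (simp add: P_def)
  moreover have "(\<lambda>n. S (t k) (e (diagseq (Suc k + n))) \<omega>) \<longlonglongrightarrow> Q (t k) \<omega> \<longleftrightarrow>
      (\<lambda>n. S (t k) (e (diagseq n)) \<omega>) \<longlonglongrightarrow> Q (t k) \<omega>" for k \<omega>
    using LIMSEQ_ignore_initial_segment[of "\<lambda>n. S (t k) (e (diagseq n)) \<omega>" _ "Suc k"]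
       LIMSEQ_offset[of "\<lambda>n. S (t k) (e (diagseq n)) \<omega>" "Suc k"] by (auto simp: add.commute)
  ultimately have "AE \<omega> in M. \<forall>k. (\<lambda>n. S (t k) (e (diagseq n)) \<omega>) \<longlonglongrightarrow> Q (t k) \<omega>"
    unfolding AE_all_countable by simp
  moreover have "\<exists>k. s = t k" if "s \<in> D" for s
    using from_nat_into_surj[OF D that] by (auto simp: t_def)
  ultimately have "AE \<omega> in M. \<forall>s\<in>D. (\<lambda>n. S s (e (diagseq n)) \<omega>) \<longlonglongrightarrow> Q s \<omega>"
    unfolding Ball_def by (elim eventually_mono) (metis (no_types))
  then show ?thesis using subseq_diagseq by blast
qed

text \<open>
  A pathwise implication between limits becomes one between limits in probability. Every
  sequence of parameters has a subsequence along which the hypotheses hold almost surely, so along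
  it the conclusion holds almost surely, and by dominated convergence also in
  distance. A family whose distance stayed away from 0 along some sequence would contradict this. The random
  variable \<open>J\<close> is only given path by path; \<open>J'\<close> is a measurable version of it, obtained as an almost
  sure limit.
\<close>

lemma tendsto_in_prob_pathwiseI:
  fixes S :: "'i \<Rightarrow> real \<Rightarrow> 'a \<Rightarrow> real" and Z :: "real \<Rightarrow> 'a \<Rightarrow> real"
  assumes M: "prob_space M" and D: "countable D"
    and S: "\<And>t. t \<in> D \<Longrightarrow> tendsto_in_prob M (S t) (Q t) (at_right 0)"
    and Z: "\<And>\<epsilon>. 0 < \<epsilon> \<Longrightarrow> Z \<epsilon> \<in> borel_measurable (completion M)"
    and path: "AE \<omega> in M. \<forall>e. (\<forall>n. 0 < e n) \<longrightarrow> filterlim e (at_right 0) sequentially \<longrightarrow>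
        (\<forall>t\<in>D. (\<lambda>n::nat. S t (e n) \<omega>) \<longlonglongrightarrow> Q t \<omega>) \<longrightarrow> (\<lambda>n. Z (e n) \<omega>) \<longlonglongrightarrow> J \<omega>"
  shows "\<exists>J'. (AE \<omega> in M. J' \<omega> = J \<omega>) \<and> tendsto_in_prob M Z J' (at_right 0)"
proof -
  interpret N: prob_space "completion M" by (rule prob_space.prob_space_completion[OF M])
  have subseq: "\<exists>r. strict_mono r \<and> (AE \<omega> in M. (\<lambda>n. Z (e (r n)) \<omega>) \<longlonglongrightarrow> J \<omega>)"
    if pos: "\<And>n. 0 < e n" and e: "filterlim e (at_right 0) sequentially" for e :: "nat \<Rightarrow> real"
  proof -
    obtain r where r: "strict_mono r" "AE \<omega> in M. \<forall>t\<in>D. (\<lambda>n. S t (e (r n)) \<omega>) \<longlonglongrightarrow> Q t \<omega>"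
      using tendsto_in_prob_AE_subseq_countable[OF M D, of S Q "at_right 0" e] S e by blast
    have er: "filterlim (\<lambda>n. e (r n)) (at_right 0) sequentially"
      by (rule filterlim_compose[OF e filterlim_subseq[OF r(1)]])
    from r(2) path have "AE \<omega> in M. (\<lambda>n. Z (e (r n)) \<omega>) \<longlonglongrightarrow> J \<omega>"
    proof eventually_elim
      case (elim \<omega>)
      show ?case by (rule elim(2)[rule_format, OF _ er]) (use elim(1) pos in blast)+
    qed
    with r(1) show ?thesis by blast
  qed
  define e0 :: "nat \<Rightarrow> real" where "e0 n = 1 / real (Suc n)" for n
  have e0: "filterlim e0 (at_right 0) sequentially"
    unfolding filterlim_at e0_def using LIMSEQ_inverse_real_of_nat by (auto simp: inverse_eq_divide)
  have "0 < e0 n" for n by (simp add: e0_def)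
  from subseq[OF this e0] obtain r
    where r: "strict_mono r" "AE \<omega> in M. (\<lambda>n. Z (e0 (r n)) \<omega>) \<longlonglongrightarrow> J \<omega>" by blast
  have "Z (e0 (r n)) \<in> borel_measurable (completion M)" for n by (intro Z) (auto simp: e0_def)
  then have "(\<lambda>\<omega>. lim (\<lambda>n. Z (e0 (r n)) \<omega>)) \<in> borel_measurable (completion M)"
    by (rule borel_measurable_lim_metric)
  from completion_ex_borel_measurable_real[OF this] obtain J'
    where J': "J' \<in> borel_measurable M" "AE \<omega> in M. lim (\<lambda>n. Z (e0 (r n)) \<omega>) = J' \<omega>" by blast
  have eq: "AE \<omega> in M. J' \<omega> = J \<omega>"
    using J'(2) r(2) by eventually_elim (auto dest: limI)
  have J'c: "J' \<in> borel_measurable (completion M)" using J'(1) by (rule measurable_completion)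
  have "((\<lambda>\<epsilon>. prob_dist M (Z \<epsilon>) J') \<longlongrightarrow> 0) (at_right 0)"
  proof (rule ccontr)
    assume "\<not> ?thesis"
    then obtain c where c: "c > 0" "\<not> (\<forall>\<^sub>F \<epsilon> in at_right 0. prob_dist M (Z \<epsilon>) J' < c)"
      unfolding tendsto_iff by (auto simp: dist_real_def prob_dist_nonneg)
    have "\<exists>\<epsilon>. 0 < \<epsilon> \<and> \<epsilon> < 1 / real (Suc n) \<and> c \<le> prob_dist M (Z \<epsilon>) J'" for n
      using c(2) unfolding eventually_at_right_field
      by (metis not_less of_nat_0_less_iff zero_less_Suc zero_less_divide_1_iff)
    then obtain e where e: "0 < e n" "e n < 1 / real (Suc n)" "c \<le> prob_dist M (Z (e n)) J'" for n
      by metis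
    have "e \<longlonglongrightarrow> 0"
      using e LIMSEQ_inverse_real_of_nat
      by (intro tendsto_sandwich[of "\<lambda>_. 0" e sequentially "\<lambda>n. 1 / real (Suc n)" 0])
         (auto simp: inverse_eq_divide less_imp_le)
    then have "filterlim e (at_right 0) sequentially"
      unfolding filterlim_at using e(1) by (auto intro!: always_eventually simp: less_imp_neq[THEN not_sym])
    from subseq[OF e(1) this] obtain r
      where r: "AE \<omega> in M. (\<lambda>n. Z (e (r n)) \<omega>) \<longlonglongrightarrow> J \<omega>" by blast
    have "(\<lambda>n. prob_dist M (Z (e (r n))) J') \<longlonglongrightarrow> (\<integral>\<omega>. 0 \<partial>completion M)"
      unfolding prob_dist_def
    proof (rule integral_dominated_convergence[where w="\<lambda>_. 1"])
      show "AE \<omega> in completion M. (\<lambda>n. min 1 \<bar>Z (e (r n)) \<omega> - J' \<omega>\<bar>) \<longlonglongrightarrow> 0"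
        unfolding AE_completion_iff using r eq
      proof eventually_elim
        case (elim \<omega>)
        then have "(\<lambda>n. Z (e (r n)) \<omega> - J' \<omega>) \<longlonglongrightarrow> 0" by (simp add: LIM_zero)
        then have "(\<lambda>n. min 1 \<bar>Z (e (r n)) \<omega> - J' \<omega>\<bar>) \<longlonglongrightarrow> min 1 \<bar>0\<bar>"
          by (intro tendsto_min tendsto_const tendsto_rabs)
        then show ?case by simp
      qed
      show "(\<lambda>\<omega>. min 1 \<bar>Z (e (r n)) \<omega> - J' \<omega>\<bar>) \<in> borel_measurable (completion M)" for n
        using integrable_min_one_abs[OF M Z[OF e(1)] J'c] by (rule borel_measurable_integrable)
    qed auto
    then show False
      using e(3) c(1) by (auto dest!: LIMSEQ_le_const[of _ _ c])
  qed
  moreover have "\<forall>\<^sub>F \<epsilon> in at_right 0. Z \<epsilon> \<in> borel_measurable (completion M)"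
    using Z by (auto simp: eventually_at_filter)
  ultimately show ?thesis
    using J'(1) eq by (auto simp: tendsto_in_prob_iff_prob_dist[OF M])
qed

section \<open>Convergence of the measures of squared increments\<close>

lemma set_integrable_continuous_Icc:
  fixes g :: "real \<Rightarrow> real"
  assumes "continuous_on UNIV g"
  shows "set_integrable lborel {a..b} g"
  by (rule borel_integrable_atLeastAtMost') (rule continuous_on_subset[OF assms], simp)

text \<open>
  Replacing \<open>g\<close> on each piece of a partition by its value at the left endpoint makes its integral a
  combination of values of the distribution function.
\<close>

lemma integral_step_function_error:
  fixes g :: "real \<Rightarrow> real" and t :: "nat \<Rightarrow> real"
  assumes sets: "sets \<mu> = sets borel" and fin: "emeasure \<mu> {t 0<..t N} < \<infinity>"
    and t: "\<And>i. i < N \<Longrightarrow> t i \<le> t (Suc i)"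
    and g: "set_integrable \<mu> {t 0<..t N} g"
    and osc: "\<And>i y. i < N \<Longrightarrow> t i < y \<Longrightarrow> y \<le> t (Suc i) \<Longrightarrow> \<bar>g y - g (t i)\<bar> \<le> \<eta>"
  shows "\<bar>(LINT y:{t 0<..t N}|\<mu>. g y) - (\<Sum>i<N. g (t i) * measure \<mu> {t i<..t (Suc i)})\<bar>
    \<le> \<eta> * measure \<mu> {t 0<..t N}"
  using fin t g osc
proof (induction N)
  case 0
  then show ?case by (simp add: set_lebesgue_integral_def)
next
  case (Suc N)
  note [simp, measurable_cong] = sets
  have tN: "t N \<le> t (Suc N)" by (rule Suc.prems(2)) simp
  have "t 0 \<le> t i" if "i \<le> N" for i
    using that
  proof (induction i)
    case (Suc i)
    then show ?case using Suc.prems Suc(2) \<open>\<And>i. i < Suc N \<Longrightarrow> t i \<le> t (Suc i)\<close>[of i] by auto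
  qed simp
  then have t0: "t 0 \<le> t N" by simp
  let ?A = "{t 0<..t N}" and ?B = "{t N<..t (Suc N)}" and ?C = "{t 0<..t (Suc N)}"
  have C: "?C = ?A \<union> ?B" "?A \<inter> ?B = {}" using tN t0 by auto
  have fA: "emeasure \<mu> ?A < \<infinity>" and fB: "emeasure \<mu> ?B < \<infinity>"
    using Suc.prems(1) C(1) by (auto intro: le_less_trans[OF emeasure_mono])
  have gA: "set_integrable \<mu> ?A g" and gB: "set_integrable \<mu> ?B g"
    using C(1) by (auto intro: set_integrable_subset[OF Suc.prems(3)])
  have mC: "measure \<mu> ?C = measure \<mu> ?A + measure \<mu> ?B"
    unfolding C(1) using fA fB C(2) by (intro measure_Union) auto
  have gC: "(LINT y:?C|\<mu>. g y) = (LINT y:?A|\<mu>. g y) + (LINT y:?B|\<mu>. g y)"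
    unfolding C(1) by (rule set_integral_Un[OF C(2) gA gB])
  have iB: "integrable \<mu> (indicator ?B :: real \<Rightarrow> real)"
    using fB by (intro integrable_real_indicator) auto
  have "\<bar>(LINT y:?B|\<mu>. g y) - g (t N) * measure \<mu> ?B\<bar> = \<bar>\<integral>y. indicator ?B y * (g y - g (t N)) \<partial>\<mu>\<bar>"
    using gB iB unfolding set_lebesgue_integral_def set_integrable_def
    by (simp add: right_diff_distrib mult.commute[of _ "g (t N)"])
  also have "\<dots> \<le> (\<integral>y. \<bar>indicator ?B y * (g y - g (t N))\<bar> \<partial>\<mu>)"
    by (rule integral_abs_bound)
  also have "\<dots> \<le> (\<integral>y. \<eta> * indicator ?B y \<partial>\<mu>)"
  proof (rule integral_mono)
    show "integrable \<mu> (\<lambda>y. \<bar>indicator ?B y * (g y - g (t N))\<bar>)"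
      using gB iB unfolding set_integrable_def
      by (intro integrable_abs) (simp add: right_diff_distrib)
    show "integrable \<mu> (\<lambda>y. \<eta> * indicator ?B y)" using iB by simp
    show "\<bar>indicator ?B y * (g y - g (t N))\<bar> \<le> \<eta> * indicator ?B y" for y
      using Suc.prems(4)[of N y] by (auto simp: indicator_def)
  qed
  also have "\<dots> = \<eta> * measure \<mu> ?B" by simp
  finally have B: "\<bar>(LINT y:?B|\<mu>. g y) - g (t N) * measure \<mu> ?B\<bar> \<le> \<eta> * measure \<mu> ?B" .
  have "\<bar>(LINT y:?A|\<mu>. g y) - (\<Sum>i<N. g (t i) * measure \<mu> {t i<..t (Suc i)})\<bar> \<le> \<eta> * measure \<mu> ?A"
    by (rule Suc.IH) (use fA gA Suc.prems in auto)
  with B show ?case unfolding gC mC by (simp add: algebra_simps)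
qed

lemma set_integrable_continuous_Ioc:
  fixes g :: "real \<Rightarrow> real"
  assumes sets: "sets \<mu> = sets borel" and fin: "emeasure \<mu> {a<..b} < \<infinity>" and g: "continuous_on {a..b} g"
  shows "set_integrable \<mu> {a<..b} g"
proof -
  note [measurable_cong] = sets
  have "bounded (g ` {a..b})"
    by (rule compact_imp_bounded[OF compact_continuous_image[OF g compact_Icc]])
  then obtain C where C: "\<And>y. y \<in> {a..b} \<Longrightarrow> norm (g y) \<le> C"
    unfolding bounded_iff by blast
  have m: "(\<lambda>y. indicator {a<..b} y *\<^sub>R g y) \<in> borel_measurable \<mu>"
    using borel_measurable_continuous_on_indicator[OF _ continuous_on_subset[OF g, of "{a<..b}"]]
    by (simp add: measurable_cong_sets[OF sets refl] greaterThanAtMost_subseteq_atLeastAtMost_iff)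
  show ?thesis
    unfolding set_integrable_def
    by (rule integrableI_bounded_set[where A="{a<..b}" and B=C])
       (use fin C m in \<open>auto simp: sets indicator_def simp del: indicator_simps\<close>)
qed

text \<open>
  The Helly-Bray theorem on a bounded interval, without normalisation of the total mass: the
  integral of a step function is a combination of values of the distribution functions, and \<open>g\<close> is
  uniformly close to a step function.
\<close>

lemma integral_tendsto_of_distribution_functions:
  fixes \<nu> :: "nat \<Rightarrow> real measure" and g :: "real \<Rightarrow> real"
  assumes "a \<le> b"
    and sets: "sets \<mu> = sets borel" "\<And>n. sets (\<nu> n) = sets borel"
    and fin: "emeasure \<mu> {a<..b} < \<infinity>" "\<And>n. emeasure (\<nu> n) {a<..b} < \<infinity>"
    and lim: "\<And>t. t \<in> {a..b} \<Longrightarrow> (\<lambda>n. measure (\<nu> n) {a<..t}) \<longlonglongrightarrow> measure \<mu> {a<..t}"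
    and g: "continuous_on {a..b} g"
  shows "(\<lambda>n. LINT y:{a<..b}|\<nu> n. g y) \<longlonglongrightarrow> (LINT y:{a<..b}|\<mu>. g y)"
proof (rule tendstoI)
  fix r :: real assume "0 < r"
  define m where "m = measure \<mu> {a<..b}"
  have "0 \<le> m" by (simp add: m_def)
  define \<eta> where "\<eta> = r / (4 * (m + 1))"
  have \<eta>: "0 < \<eta>" "\<eta> * (m + 1) = r / 4"
    using \<open>0 < r\<close> \<open>0 \<le> m\<close> by (auto simp: \<eta>_def field_simps add_nonneg_eq_0_iff)
  have "uniformly_continuous_on {a..b} g" by (rule compact_uniformly_continuous[OF g]) auto
  then obtain \<delta> where \<delta>: "\<delta> > 0" "\<And>x y. x \<in> {a..b} \<Longrightarrow> y \<in> {a..b} \<Longrightarrow> dist y x < \<delta> \<Longrightarrow> dist (g y) (g x) < \<eta>"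
    using \<eta>(1) unfolding uniformly_continuous_on_def by metis
  obtain N :: nat where "(b - a) / \<delta> < N" using reals_Archimedean2 by blast
  then have N: "(b - a) < \<delta> * Suc N" using \<delta>(1) by (simp add: field_simps)
  define K where "K = real (Suc N)"
  have K: "K > 0" by (simp add: K_def)
  define t where "t i = a + (b - a) * (real i / K)" for i
  have t0: "t 0 = a" by (simp add: t_def)
  have tN: "t (Suc N) = b" using K by (simp only: t_def flip: K_def) simp
  have t_mono: "t i \<le> t j" if "i \<le> j" for i j
    using that \<open>a \<le> b\<close> K by (auto simp: t_def intro!: mult_left_mono divide_right_mono)
  have t_mem: "t i \<in> {a..b}" if "i \<le> Suc N" for i
    using t_mono[of 0 i] t_mono[OF that] by (simp add: t0 tN)
  have t_step: "t (Suc i) - t i < \<delta>" for i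
  proof -
    have "t (Suc i) - t i = (b - a) / K" using K by (simp add: t_def field_simps)
    also have "\<dots> < \<delta>" using N K unfolding K_def[symmetric] by (simp add: pos_divide_less_eq)
    finally show ?thesis .
  qed
  have osc: "\<bar>g y - g (t i)\<bar> \<le> \<eta>" if "i < Suc N" "t i < y" "y \<le> t (Suc i)" for i y
  proof -
    have "dist (g y) (g (t i)) < \<eta>"
      using that t_mem[of i] t_mem[of "Suc i"] t_step[of i] by (intro \<delta>(2)) (auto simp: dist_real_def)
    then show ?thesis by (simp add: dist_real_def)
  qed
  let ?S = "\<lambda>\<kappa>. \<Sum>i<Suc N. g (t i) * measure \<kappa> {t i<..t (Suc i)}"
  have err: "\<bar>(LINT y:{a<..b}|\<kappa>. g y) - ?S \<kappa>\<bar> \<le> \<eta> * measure \<kappa> {a<..b}"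
    if "sets \<kappa> = sets borel" "emeasure \<kappa> {a<..b} < \<infinity>" for \<kappa>
    using integral_step_function_error[of \<kappa> t "Suc N" g \<eta>] that
      set_integrable_continuous_Ioc[OF that g] t_mono osc
    unfolding t0 tN by auto
  have split: "measure \<kappa> {t i<..t (Suc i)} = measure \<kappa> {a<..t (Suc i)} - measure \<kappa> {a<..t i}"
    if "sets \<kappa> = sets borel" "emeasure \<kappa> {a<..b} < \<infinity>" "i < Suc N" for i \<kappa>
  proof -
    have "measure \<kappa> ({a<..t (Suc i)} - {a<..t i}) = measure \<kappa> {a<..t (Suc i)} - measure \<kappa> {a<..t i}"
    proof (rule measure_Diff)
      have "emeasure \<kappa> {a<..t (Suc i)} \<le> emeasure \<kappa> {a<..b}"
        using that t_mem[of "Suc i"] by (intro emeasure_mono) auto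
      with that show "emeasure \<kappa> {a<..t (Suc i)} \<noteq> \<infinity>" by (auto simp: less_top top_unique)
    qed (use that t_mono[of i "Suc i"] in auto)
    also have "{a<..t (Suc i)} - {a<..t i} = {t i<..t (Suc i)}"
      using t_mem[of i] that t_mono[of i "Suc i"] by auto
    finally show ?thesis .
  qed
  have S: "(\<lambda>n. ?S (\<nu> n)) \<longlonglongrightarrow> ?S \<mu>"
  proof (intro tendsto_sum tendsto_mult tendsto_const)
    fix i assume i: "i \<in> {..<Suc N}"
    then show "(\<lambda>n. measure (\<nu> n) {t i<..t (Suc i)}) \<longlonglongrightarrow> measure \<mu> {t i<..t (Suc i)}"
      using sets fin t_mem[of i] t_mem[of "Suc i"]
      by (simp add: split) (intro tendsto_diff lim; simp)
  qed
  have "\<forall>\<^sub>F n in sequentially. dist (?S (\<nu> n)) (?S \<mu>) < r / 4"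
    using S \<open>0 < r\<close> by (intro tendstoD) auto
  moreover have "\<forall>\<^sub>F n in sequentially. measure (\<nu> n) {a<..b} < m + 1"
    using lim[of b] \<open>a \<le> b\<close> unfolding m_def by (intro order_tendstoD(2)[of _ "measure \<mu> {a<..b}"]) auto
  ultimately show "\<forall>\<^sub>F n in sequentially. dist (LINT y:{a<..b}|\<nu> n. g y) (LINT y:{a<..b}|\<mu>. g y) < r"
  proof eventually_elim
    case (elim n)
    have "\<eta> * measure (\<nu> n) {a<..b} \<le> \<eta> * (m + 1)" "\<eta> * m \<le> \<eta> * (m + 1)"
      using elim(2) \<eta>(1) by auto
    with err[OF sets(1) fin(1)] err[OF sets(2) fin(2), of n] elim(1) show ?case
      unfolding m_def[symmetric] \<eta>(2) dist_real_def by linarith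
  qed
qed

lemma LBINT_Ioc_eq_Icc:
  fixes g :: "real \<Rightarrow> real"
  shows "(LBINT y:{a<..b}. g y) = (LBINT y:{a..b}. g y)"
proof (cases "a \<le> b")
  case True
  then show ?thesis
    using interval_integral_Icc[of a b g] interval_integral_Ioc[of a b g] by simp
qed (simp add: set_lebesgue_integral_def)

text \<open>
  A continuous \<open>V\<close> puts no mass on the left endpoint. The restrictions of \<open>g\<close> to the two intervals are
  measurable together; if they are not, both integrals are 0 by convention.
\<close>

lemma LINT_interval_measure_Ioc_eq_Icc:
  fixes g V :: "real \<Rightarrow> real"
  assumes V: "\<And>x y. x \<le> y \<Longrightarrow> V x \<le> V y" "continuous_on UNIV V"
  shows "(LINT y:{a<..b}|interval_measure V. g y) = (LINT y:{a..b}|interval_measure V. g y)"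
proof -
  have "emeasure (interval_measure V) {a} = 0"
    using emeasure_interval_measure_Icc[of a a V] V by simp
  then have "AE y in interval_measure V. y \<noteq> a"
    by (intro AE_I[of _ _ "{a}"]) auto
  then have AE: "AE y in interval_measure V. y \<in> {a<..b} \<longleftrightarrow> y \<in> {a..b}"
    by eventually_elim auto
  show ?thesis
  proof (cases "set_borel_measurable (interval_measure V) {a..b} g")
    case True
    then have "set_borel_measurable (interval_measure V) {a<..b} g"
      by (rule set_borel_measurable_subset) auto
    then show ?thesis using True AE by (intro set_integral_cong_set) auto
  next
    case False
    have "\<not> set_borel_measurable (interval_measure V) {a<..b} g"
    proof
      assume "set_borel_measurable (interval_measure V) {a<..b} g"
      then have "(\<lambda>y. indicator {a<..b} y *\<^sub>R g y + (if y = a \<and> a \<le> b then g a else 0)) \<in> borel_measurable (interval_measure V)"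
        unfolding set_borel_measurable_def by measurable
      also have "(\<lambda>y. indicator {a<..b} y *\<^sub>R g y + (if y = a \<and> a \<le> b then g a else 0)) = (\<lambda>y. indicator {a..b} y *\<^sub>R g y)"
        by (auto simp: indicator_def)
      finally show False using False by (simp add: set_borel_measurable_def)
    qed
    with False show ?thesis
      unfolding set_lebesgue_integral_def set_borel_measurable_def
      by (metis (no_types) borel_measurable_integrable not_integrable_integral_eq)
  qed
qed

lemma set_integral_density_Icc:
  fixes g h :: "real \<Rightarrow> real"
  assumes [measurable]: "h \<in> borel_measurable borel" "g \<in> borel_measurable borel" and h: "\<And>y. 0 \<le> h y"
  shows "(LINT y:{a<..b}|density lborel h. g y) = (LBINT y:{a..b}. h y * g y)"
proof -
  have "(LINT y:{a<..b}|density lborel h. g y) = (\<integral>y. h y *\<^sub>R (indicator {a<..b} y *\<^sub>R g y) \<partial>lborel)"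
    unfolding set_lebesgue_integral_def by (rule integral_density) (auto simp: h)
  also have "\<dots> = (LBINT y:{a<..b}. h y * g y)"
    by (simp add: set_lebesgue_integral_def mult_ac)
  finally show ?thesis by (simp add: LBINT_Ioc_eq_Icc)
qed

lemma measure_density_Ioc:
  fixes h :: "real \<Rightarrow> real"
  assumes h: "continuous_on UNIV h" "\<And>y. 0 \<le> h y"
  shows "measure (density lborel h) {a<..b} = (LBINT y:{a..b}. h y)"
    and "emeasure (density lborel h) {a<..b} < \<infinity>"
proof -
  have [measurable]: "h \<in> borel_measurable borel" using h(1) by (rule borel_measurable_continuous_onI)
  have "set_integrable lborel {a..b} h"
    by (rule borel_integrable_atLeastAtMost') (rule continuous_on_subset[OF h(1)], simp)
  then have int: "set_integrable lborel {a<..b} h"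
    by (rule set_integrable_subset) auto
  have "emeasure (density lborel h) {a<..b} = (\<integral>\<^sup>+y. ennreal (indicator {a<..b} y * h y) \<partial>lborel)"
    using h(2) by (auto simp: emeasure_density indicator_def intro!: nn_integral_cong)
  also have "\<dots> = ennreal (LBINT y:{a<..b}. h y)"
    using int h(2) unfolding set_lebesgue_integral_def set_integrable_def
    by (subst nn_integral_eq_integral) (auto simp: indicator_def)
  finally have *: "emeasure (density lborel h) {a<..b} = ennreal (LBINT y:{a<..b}. h y)" .
  moreover have "0 \<le> (LBINT y:{a<..b}. h y)"
    using h(2) by (auto simp: set_lebesgue_integral_def intro!: integral_nonneg_AE)
  ultimately show "measure (density lborel h) {a<..b} = (LBINT y:{a..b}. h y)"
    by (simp add: measure_def LBINT_Ioc_eq_Icc)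
  show "emeasure (density lborel h) {a<..b} < \<infinity>" by (simp add: *)
qed

text \<open>
  The functions whose limits are assumed are the distribution functions of the measures with
  density \<open>(w (y + \<epsilon>) - w y)\<^sup>2 / \<epsilon>\<close>.
\<close>

lemma integral_square_increments_tendsto:
  fixes w V g :: "real \<Rightarrow> real" and e :: "nat \<Rightarrow> real"
  assumes w: "continuous_on UNIV w"
    and V: "\<And>x y. x \<le> y \<Longrightarrow> V x \<le> V y" "continuous_on UNIV V" "V 0 = 0"
    and e: "\<And>n. 0 < e n" and c: "0 \<le> c"
    and lim: "\<And>t. t \<in> {0..c} \<Longrightarrow> (\<lambda>n. 1 / e n * (LBINT s:{0..t}. (w (s + e n) - w s)\<^sup>2)) \<longlonglongrightarrow> V t"
    and g: "continuous_on {0..c} g"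
  shows "(\<lambda>n. LBINT y:{0..c}. g y * ((w (y + e n) - w y)\<^sup>2 / e n)) \<longlonglongrightarrow>
    (LINT y:{0..c}|interval_measure V. g y)"
proof -
  \<comment> \<open>A globally continuous, hence Borel measurable, extension of \<open>g\<close>.\<close>
  define g' where "g' y = g (max 0 (min c y))" for y
  have g': "continuous_on UNIV g'"
    unfolding g'_def using c
    by (intro continuous_on_compose2[OF g] continuous_intros) auto
  have [measurable]: "g' \<in> borel_measurable borel" by (rule borel_measurable_continuous_onI[OF g'])
  have gg': "g' y = g y" if "y \<in> {0..c}" for y using that by (simp add: g'_def min_absorb2)
  define h where "h n y = (w (y + e n) - w y)\<^sup>2 / e n" for n y
  have hc: "continuous_on UNIV (h n)" for n
    unfolding h_def by (intro continuous_intros continuous_on_compose2[OF w]) (auto simp: e less_imp_neq[THEN not_sym])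
  have hm [measurable]: "h n \<in> borel_measurable borel" for n by (rule borel_measurable_continuous_onI[OF hc])
  have h0: "0 \<le> h n y" for n y using e[of n] by (simp add: h_def)
  have V': "continuous (at_right a) V" for a
    using V(2) by (simp add: continuous_on_eq_continuous_within continuous_at_imp_continuous_within)
  have "(\<lambda>n. LINT y:{0<..c}|density lborel (h n). g' y) \<longlonglongrightarrow> (LINT y:{0<..c}|interval_measure V. g' y)"
  proof (rule integral_tendsto_of_distribution_functions[OF c])
    show "emeasure (interval_measure V) {0<..c} < \<infinity>"
      using emeasure_interval_measure_Ioc[OF c V(1) V'] by simp
    show "(\<lambda>n. measure (density lborel (h n)) {0<..t}) \<longlonglongrightarrow> measure (interval_measure V) {0<..t}"
      if "t \<in> {0..c}" for t
      using lim[OF that] measure_interval_measure_Ioc[of 0 t, OF _ V(1) V'] that V(3)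
      by (simp add: measure_density_Ioc(1)[OF hc h0]) (simp add: h_def)
    show "continuous_on {0..c} g'" by (rule continuous_on_subset[OF g']) simp
  qed (use measure_density_Ioc(2)[OF hc h0] in auto)
  then have "(\<lambda>n. LBINT y:{0..c}. h n y * g' y) \<longlonglongrightarrow> (LINT y:{0..c}|interval_measure V. g' y)"
    by (simp add: set_integral_density_Icc h0 LINT_interval_measure_Ioc_eq_Icc[OF V(1,2)])
  moreover have "(LBINT y:{0..c}. h n y * g' y) = (LBINT y:{0..c}. g y * ((w (y + e n) - w y)\<^sup>2 / e n))" for n
    by (rule set_lebesgue_integral_cong) (auto simp: gg' h_def)
  moreover have "(LINT y:{0..c}|interval_measure V. g' y) = (LINT y:{0..c}|interval_measure V. g y)"
    by (rule set_lebesgue_integral_cong) (auto simp: gg')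
  ultimately show ?thesis by simp
qed

text \<open>
  Monotone functions that converge on a dense set to a continuous limit converge everywhere, by
  squeezing between neighbouring points of the set. The endpoint \<open>T\<close> may be irrational and is added to the set.
\<close>

lemma distribution_functions_tendsto:
  fixes S :: "nat \<Rightarrow> real \<Rightarrow> real" and q :: "real \<Rightarrow> real"
  assumes mono: "\<And>n s t. 0 \<le> s \<Longrightarrow> s \<le> t \<Longrightarrow> t \<le> T \<Longrightarrow> S n s \<le> S n t"
    and q: "continuous_on {0..T} q"
    and lim: "\<And>t. t \<in> insert T (\<rat> \<inter> {0..T}) \<Longrightarrow> (\<lambda>n. S n t) \<longlonglongrightarrow> q t"
    and t: "t \<in> {0..T}"
  shows "(\<lambda>n. S n t) \<longlonglongrightarrow> q t"
proof (rule tendstoI)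
  fix r :: real assume r: "0 < r"
  obtain \<delta> where \<delta>: "\<delta> > 0" "\<And>s. s \<in> {0..T} \<Longrightarrow> dist s t < \<delta> \<Longrightarrow> dist (q s) (q t) < r / 2"
    using q t r unfolding continuous_on_iff by (metis half_gt_zero)
  obtain d where d: "d \<in> insert T (\<rat> \<inter> {0..T})" "t \<le> d" "d < t + \<delta>"
  proof (cases "t = T")
    case True
    then show thesis using \<delta>(1) that[of T] by simp
  next
    case False
    then have "t < min T (t + \<delta>)" using t \<delta>(1) by auto
    from Rats_dense_in_real[OF this] obtain d where "d \<in> \<rat>" "t < d" "d < min T (t + \<delta>)" by blast
    then show thesis using t that[of d] by auto
  qed
  obtain d' where d': "d' \<in> insert T (\<rat> \<inter> {0..T})" "d' \<le> t" "t - \<delta> < d'"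
  proof (cases "t = 0")
    case True
    then show thesis using \<delta>(1) t that[of 0] by simp
  next
    case False
    then have "max 0 (t - \<delta>) < t" using t \<delta>(1) by auto
    from Rats_dense_in_real[OF this] obtain d' where "d' \<in> \<rat>" "max 0 (t - \<delta>) < d'" "d' < t" by blast
    then show thesis using t that[of d'] by auto
  qed
  have dT: "d \<in> {0..T}" "d' \<in> {0..T}" using d d' t by auto
  have q': "dist (q d) (q t) < r / 2" "dist (q d') (q t) < r / 2"
    by (rule \<delta>(2); use dT d d' \<delta>(1) in \<open>simp add: dist_real_def\<close>)+
  have "\<forall>\<^sub>F n in sequentially. dist (S n d) (q d) < r / 2"
    "\<forall>\<^sub>F n in sequentially. dist (S n d') (q d') < r / 2"
    using lim[OF d(1)] lim[OF d'(1)] r by (auto dest!: tendstoD[where e="r / 2"])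
  then show "\<forall>\<^sub>F n in sequentially. dist (S n t) (q t) < r"
  proof eventually_elim
    case (elim n)
    have "S n d' \<le> S n t" "S n t \<le> S n d" using dT d d' t by (auto intro!: mono)
    with elim q' show ?case unfolding dist_real_def by linarith
  qed
qed

lemma LBINT_square_increments_mono:
  fixes w :: "real \<Rightarrow> real"
  assumes w: "continuous_on UNIV w" and "0 < \<epsilon>" "s \<le> t"
  shows "1 / \<epsilon> * (LBINT y:{0..s}. (w (y + \<epsilon>) - w y)\<^sup>2) \<le> 1 / \<epsilon> * (LBINT y:{0..t}. (w (y + \<epsilon>) - w y)\<^sup>2)"
proof -
  have "continuous_on UNIV (\<lambda>y. (w (y + \<epsilon>) - w y)\<^sup>2)"
    by (intro continuous_intros continuous_on_compose2[OF w]) auto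
  then have i: "integrable lborel (\<lambda>y. indicator {0..b} y *\<^sub>R (w (y + \<epsilon>) - w y)\<^sup>2)" for b
    by (rule set_integrable_continuous_Icc[unfolded set_integrable_def])
  have "(LBINT y:{0..s}. (w (y + \<epsilon>) - w y)\<^sup>2) \<le> (LBINT y:{0..t}. (w (y + \<epsilon>) - w y)\<^sup>2)"
    unfolding set_lebesgue_integral_def
    by (rule integral_mono[OF i i]) (use \<open>s \<le> t\<close> in \<open>auto simp: indicator_def\<close>)
  then show ?thesis using \<open>0 < \<epsilon>\<close> by (simp add: divide_right_mono)
qed

lemma continuous_on_clamp:
  fixes X :: "real \<Rightarrow> real"
  assumes "continuous_on {0..T} X" "0 \<le> T"
  shows "continuous_on UNIV (\<lambda>t. X (max 0 (min t T)))"
  by (intro continuous_on_compose2[OF assms(1)] continuous_intros) (use assms(2) in auto)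

section \<open>Integrals over moving intervals and over a strip\<close>

lemma abs_integral_le_indicator:
  fixes h :: "real \<Rightarrow> real"
  assumes "\<And>x. \<bar>h x\<bar> \<le> \<rho> * indicator {a..b} x" "a \<le> b"
  shows "\<bar>\<integral>x. h x \<partial>lborel\<bar> \<le> \<rho> * (b - a)"
proof -
  have \<rho>: "0 \<le> \<rho>" using assms(1)[of a] assms(2) by simp
  show ?thesis
  proof (cases "integrable lborel h")
    case True
    have "\<bar>\<integral>x. h x \<partial>lborel\<bar> \<le> (\<integral>x. \<bar>h x\<bar> \<partial>lborel)" by (rule integral_abs_bound)
    also have "\<dots> \<le> (\<integral>x. \<rho> * indicator {a..b} x \<partial>lborel)"
      using True assms by (intro integral_mono integrable_abs) auto
    also have "\<dots> = \<rho> * (b - a)" using assms(2) by simp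
    finally show ?thesis .
  next
    case False
    then show ?thesis using \<rho> assms(2) by (simp add: not_integrable_integral_eq)
  qed
qed

lemma abs_LBINT_le:
  fixes h :: "real \<Rightarrow> real"
  assumes "\<And>x. x \<in> {a..b} \<Longrightarrow> \<bar>h x\<bar> \<le> \<rho>" "a \<le> b"
  shows "\<bar>LBINT x:{a..b}. h x\<bar> \<le> \<rho> * (b - a)"
  unfolding set_lebesgue_integral_def
  by (rule abs_integral_le_indicator) (use assms in \<open>auto simp: indicator_def\<close>)

lemma LBINT_rescale:
  fixes g :: "real \<Rightarrow> real"
  assumes "a \<le> b"
  shows "(LBINT t:{a..b}. g t) = (b - a) * (LBINT u:{0..1}. g (a + (b - a) * u))"
proof (cases "a = b")
  case True
  have "(LBINT t:{a..a}. g t) = 0"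
    using LBINT_Ioc_eq_Icc[of a a g] by (simp add: set_lebesgue_integral_def)
  then show ?thesis using True by simp
next
  case False
  then have c: "b - a > 0" using assms by simp
  have "(LBINT t:{a..b}. g t) = \<bar>b - a\<bar> * (\<integral>u. indicator {a..b} (a + (b - a) * u) * g (a + (b - a) * u) \<partial>lborel)"
    unfolding set_lebesgue_integral_def using c by (subst lborel_integral_real_affine[of "b - a" _ a]) auto
  moreover have "indicator {a..b} (a + (b - a) * u) = (indicator {0..1} u :: real)" for u
  proof -
    have "a + (b - a) * u \<le> b \<longleftrightarrow> (b - a) * u \<le> (b - a) * 1" by auto
    also have "\<dots> \<longleftrightarrow> u \<le> 1" using c by (subst mult_le_cancel_left_pos) auto
    finally show ?thesis using c by (auto simp: indicator_def zero_le_mult_iff)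
  qed
  ultimately show ?thesis using c by (simp add: set_lebesgue_integral_def)
qed

text \<open>
  Rescaling the moving interval to \<open>[0,1]\<close> moves the dependence on \<open>y\<close> into the integrand.
\<close>

lemma continuous_on_LBINT_param:
  fixes \<phi> :: "real \<times> real \<Rightarrow> real"
  assumes \<phi>: "continuous_on UNIV \<phi>" and \<alpha>: "continuous_on S \<alpha>" and \<beta>: "continuous_on S \<beta>"
    and le: "\<And>y. y \<in> S \<Longrightarrow> \<alpha> y \<le> \<beta> y"
  shows "continuous_on S (\<lambda>y. LBINT t:{\<alpha> y..\<beta> y}. \<phi> (y, t))"
proof -
  let ?g = "\<lambda>y u. \<phi> (y, \<alpha> y + (\<beta> y - \<alpha> y) * u)"
  have g: "continuous_on (S \<times> cbox 0 1) (\<lambda>(y, u). ?g y u)"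
    unfolding split_beta
    by (intro continuous_on_compose2[OF \<phi>] continuous_intros continuous_on_compose2[OF \<alpha>] continuous_on_compose2[OF \<beta>]) auto
  have eq: "(LBINT t:{\<alpha> y..\<beta> y}. \<phi> (y, t)) = (\<beta> y - \<alpha> y) * integral (cbox 0 1) (?g y)" if "y \<in> S" for y
  proof -
    have "continuous_on {0..1} (?g y)"
      by (intro continuous_on_compose2[OF \<phi>] continuous_intros) auto
    then have "set_integrable lborel {0..1} (?g y)" by (rule borel_integrable_atLeastAtMost')
    then show ?thesis
      using LBINT_rescale[OF le[OF that], of "\<lambda>t. \<phi> (y, t)"] set_borel_integral_eq_integral(2)
      by fastforce
  qed
  have "continuous_on S (\<lambda>y. (\<beta> y - \<alpha> y) * integral (cbox 0 1) (?g y))"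
    by (intro continuous_intros \<alpha> \<beta> integral_continuous_on_param g)
  then show ?thesis using eq by (simp cong: continuous_on_cong)
qed

lemma LBINT_translate:
  fixes g :: "real \<Rightarrow> real"
  shows "(LBINT x:{a..b}. g (x + c)) = (LBINT s:{a + c..b + c}. g s)"
proof -
  have "(LBINT s:{a + c..b + c}. g s) = (\<integral>x. indicator {a + c..b + c} (c + 1 * x) *\<^sub>R g (c + 1 * x) \<partial>lborel)"
    unfolding set_lebesgue_integral_def by (subst lborel_integral_real_affine[of 1 _ c]) auto
  also have "\<dots> = (LBINT x:{a..b}. g (x + c))"
    unfolding set_lebesgue_integral_def
    by (intro Bochner_Integration.integral_cong) (auto simp: indicator_def add.commute)
  finally show ?thesis by simp
qed

lemma Fubini_bounded_region:
  fixes h :: "real \<times> real \<Rightarrow> real"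
  assumes \<mu>: "sigma_finite_measure \<mu>" "sets \<mu> = sets borel" "emeasure \<mu> {a..b} < \<infinity>"
    and h: "h \<in> borel_measurable borel"
    and bd: "\<And>s t. \<bar>h (s, t)\<bar> \<le> C"
    and supp: "\<And>s t. h (s, t) \<noteq> 0 \<Longrightarrow> s \<in> {a..b} \<and> t \<in> {c..d}"
  shows "(\<integral>s. (\<integral>t. h (s, t) \<partial>lborel) \<partial>\<mu>) = (\<integral>t. (\<integral>s. h (s, t) \<partial>\<mu>) \<partial>lborel)"
proof -
  interpret \<mu>: sigma_finite_measure \<mu> by fact
  interpret pair_sigma_finite \<mu> lborel by unfold_locales
  have sets: "sets (\<mu> \<Otimes>\<^sub>M lborel) = sets (borel :: (real \<times> real) measure)"
    using sets_pair_measure_cong[OF \<mu>(2) sets_lborel] by (simp flip: borel_prod)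
  have "integrable (\<mu> \<Otimes>\<^sub>M lborel) h"
  proof (rule integrableI_bounded_set[where A="{a..b} \<times> {c..d}" and B=C])
    show "h \<in> borel_measurable (\<mu> \<Otimes>\<^sub>M lborel)" using h by (simp add: measurable_cong_sets[OF sets refl])
    show "{a..b} \<times> {c..d} \<in> sets (\<mu> \<Otimes>\<^sub>M lborel)" using \<mu>(2) by auto
    have "emeasure (\<mu> \<Otimes>\<^sub>M lborel) ({a..b} \<times> {c..d}) = emeasure \<mu> {a..b} * emeasure lborel {c..d}"
      using \<mu>(2) by (intro lborel.emeasure_pair_measure_Times) auto
    also have "\<dots> < \<infinity>" using \<mu>(3) by (auto simp: emeasure_lborel_Icc_eq ennreal_mult_less_top)
    finally show "emeasure (\<mu> \<Otimes>\<^sub>M lborel) ({a..b} \<times> {c..d}) < \<infinity>" .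
  qed (use bd supp in auto)
  then have "integrable (\<mu> \<Otimes>\<^sub>M lborel) (case_prod (\<lambda>s t. h (s, t)))" by simp
  from Fubini_integral[OF this] show ?thesis by simp
qed

text \<open>
  Both measures agree on half-open intervals, which generate the Borel sets.
\<close>

lemma interval_measure_translate:
  fixes V :: "real \<Rightarrow> real"
  assumes V: "\<And>x y. x \<le> y \<Longrightarrow> V x \<le> V y" "continuous_on UNIV V"
  shows "interval_measure (\<lambda>t. V (t + x)) = distr (interval_measure V) borel (\<lambda>s. s - x)"
proof (rule measure_eqI_generator_eq[where E="range (\<lambda>(a, b). {a<..b})" and \<Omega>=UNIV
      and A="\<lambda>i. {- real i<..real i}"])
  have rc: "continuous (at_right a) V" for a
    using V(2) by (simp add: continuous_on_eq_continuous_within continuous_at_imp_continuous_within)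
  have rc': "continuous (at_right a) (\<lambda>t. V (t + x))" for a
  proof -
    have "continuous_on UNIV (\<lambda>t. V (t + x))"
      by (intro continuous_on_compose2[OF V(2)] continuous_intros) auto
    then show ?thesis
      by (simp add: continuous_on_eq_continuous_within continuous_at_imp_continuous_within)
  qed
  have mono': "V (s + x) \<le> V (t + x)" if "s \<le> t" for s t using that by (intro V(1)) simp
  have em: "emeasure (interval_measure (\<lambda>t. V (t + x))) {a<..b} = (if a \<le> b then V (b + x) - V (a + x) else 0)" for a b
    by (rule emeasure_interval_measure_Ioc_eq[OF mono' rc'])
  show "Int_stable (range (\<lambda>(a, b). {a<..b::real}))"
    by (auto simp: Int_stable_def)
  show "emeasure (interval_measure (\<lambda>t. V (t + x))) {- real i<..real i} \<noteq> \<infinity>" for i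
    by (simp add: em)
  show "emeasure (interval_measure (\<lambda>t. V (t + x))) A = emeasure (distr (interval_measure V) borel (\<lambda>s. s - x)) A"
    if "A \<in> range (\<lambda>(a, b). {a<..b::real})" for A
  proof -
    from that obtain a b where A: "A = {a<..b}" by auto
    have "(\<lambda>s. s - x) -` {a<..b} = {a + x<..b + x}" by auto
    then have "emeasure (distr (interval_measure V) borel (\<lambda>s. s - x)) A = (if a \<le> b then V (b + x) - V (a + x) else 0)"
      using emeasure_interval_measure_Ioc_eq[OF V(1) rc, of "a + x" "b + x"]
      by (subst emeasure_distr) (auto simp: A)
    then show ?thesis by (simp add: A em)
  qed
  show "(\<Union>i. {- real i<..real i}) = UNIV"
  proof safe
    fix y :: real
    obtain n where "\<bar>y\<bar> < real n" using reals_Archimedean2 by blast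
    then show "y \<in> (\<Union>i. {- real i<..real i})" by (intro UN_I[of n]) auto
  qed auto
qed (auto simp: borel_sigma_sets_Ioc)

lemma LINT_interval_measure_translate:
  fixes V g :: "real \<Rightarrow> real"
  assumes V: "\<And>x y. x \<le> y \<Longrightarrow> V x \<le> V y" "continuous_on UNIV V"
    and g: "g \<in> borel_measurable borel"
  shows "(LINT t:{a..b}|interval_measure (\<lambda>t. V (t + x)). g t) = (LINT s:{a + x..b + x}|interval_measure V. g (s - x))"
proof -
  have "(LINT t:{a..b}|interval_measure (\<lambda>t. V (t + x)). g t) =
    (\<integral>s. indicator {a..b} (s - x) *\<^sub>R g (s - x) \<partial>interval_measure V)"
  proof -
    have "(\<lambda>t. indicator {a..b} t *\<^sub>R g t) \<in> borel_measurable borel" using g by measurable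
    then show ?thesis
      unfolding set_lebesgue_integral_def
      using interval_measure_translate[where V=V and x=x, OF V] by (simp add: integral_distr)
  qed
  also have "\<dots> = (LINT s:{a + x..b + x}|interval_measure V. g (s - x))"
    unfolding set_lebesgue_integral_def by (intro Bochner_Integration.integral_cong) (auto simp: indicator_def)
  finally show ?thesis .
qed

text \<open>
  Three ways to integrate over the strip \<open>{(s, t). 0 \<le> s \<le> T, s \<le> t \<le> min (s + \<tau>) T}\<close>: along \<open>t\<close>, along \<open>s\<close>,
  and along the diagonals \<open>s - t = x\<close>. The first rearrangement, with Lebesgue measure, brings
  the regularised sums into the form of the first forward integral; the second, with \<open>d[X]\<close>, gives the
  iterated form of the last term of the formula.
\<close>

lemma strip_Fubini:
  fixes G :: "real \<times> real \<Rightarrow> real"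
  assumes \<mu>: "sigma_finite_measure \<mu>" "sets \<mu> = sets borel" "emeasure \<mu> {0..T} < \<infinity>"
    and G: "continuous_on UNIV G" and C: "\<And>p. \<bar>G p\<bar> \<le> C" and \<tau>: "0 < \<tau>"
  shows "(LINT s:{0..T}|\<mu>. LBINT t:{s..min (s + \<tau>) T}. G (s, t)) = (LBINT t:{0..T}. LINT s:{max 0 (t - \<tau>)..t}|\<mu>. G (s, t))"
    and "(LINT s:{0..T}|\<mu>. LBINT t:{s..min (s + \<tau>) T}. G (s, t)) = (LBINT x:{-\<tau>..0}. LINT s:{0..T + x}|\<mu>. G (s, s - x))"
proof -
  have C0: "0 \<le> C" using C[of undefined] by linarith
  define R where "R = {p :: real \<times> real. 0 \<le> fst p \<and> fst p \<le> T \<and> fst p \<le> snd p \<and> snd p \<le> fst p + \<tau> \<and> snd p \<le> T}"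
  have "closed R"
    unfolding R_def by (intro closed_Collect_conj closed_Collect_le continuous_intros)
  then have R [measurable]: "R \<in> sets borel" by (rule borel_closed)
  have [measurable]: "G \<in> borel_measurable borel" using G by (rule borel_measurable_continuous_onI)
  define h where "h p = indicator R p * G p" for p
  have h [measurable]: "h \<in> borel_measurable borel" unfolding h_def by measurable
  have lhs: "(LINT s:{0..T}|\<mu>. LBINT t:{s..min (s + \<tau>) T}. G (s, t)) = (\<integral>s. (\<integral>t. h (s, t) \<partial>lborel) \<partial>\<mu>)"
    unfolding set_lebesgue_integral_def scaleR_conv_of_real of_real_eq_id id_apply
    by (subst integral_mult_right_zero[symmetric], intro Bochner_Integration.integral_cong refl)
       (auto simp: h_def R_def indicator_def)
  show "(LINT s:{0..T}|\<mu>. LBINT t:{s..min (s + \<tau>) T}. G (s, t)) = (LBINT t:{0..T}. LINT s:{max 0 (t - \<tau>)..t}|\<mu>. G (s, t))"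
  proof -
    have "(\<integral>s. (\<integral>t. h (s, t) \<partial>lborel) \<partial>\<mu>) = (\<integral>t. (\<integral>s. h (s, t) \<partial>\<mu>) \<partial>lborel)"
      by (rule Fubini_bounded_region[OF \<mu> h, where C=C and c=0 and d=T])
         (use C C0 in \<open>auto simp: h_def R_def indicator_def split: if_splits\<close>)
    also have "\<dots> = (LBINT t:{0..T}. LINT s:{max 0 (t - \<tau>)..t}|\<mu>. G (s, t))"
      unfolding set_lebesgue_integral_def scaleR_conv_of_real of_real_eq_id id_apply
      by (subst integral_mult_right_zero[symmetric], intro Bochner_Integration.integral_cong refl)
         (auto simp: h_def R_def indicator_def)
    finally show ?thesis unfolding lhs .
  qed
  show "(LINT s:{0..T}|\<mu>. LBINT t:{s..min (s + \<tau>) T}. G (s, t)) = (LBINT x:{-\<tau>..0}. LINT s:{0..T + x}|\<mu>. G (s, s - x))"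
  proof -
    define k where "k p = h (fst p, fst p - snd p)" for p
    have [measurable]: "(\<lambda>p::real\<times>real. (fst p, fst p - snd p)) \<in> borel_measurable borel"
      by (intro borel_measurable_continuous_onI continuous_intros)
    have k: "k \<in> borel_measurable borel" unfolding k_def by measurable
    have "(\<integral>t. h (s, t) \<partial>lborel) = (\<integral>x. k (s, x) \<partial>lborel)" for s
      by (subst lborel_integral_real_affine[of "-1" _ s]) (auto simp: k_def)
    then have "(\<integral>s. (\<integral>t. h (s, t) \<partial>lborel) \<partial>\<mu>) = (\<integral>s. (\<integral>x. k (s, x) \<partial>lborel) \<partial>\<mu>)" by simp
    also have "\<dots> = (\<integral>x. (\<integral>s. k (s, x) \<partial>\<mu>) \<partial>lborel)"
      by (rule Fubini_bounded_region[OF \<mu> k, where C=C and c="-\<tau>" and d=0])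
         (use C C0 in \<open>auto simp: k_def h_def R_def indicator_def split: if_splits\<close>)
    also have "\<dots> = (LBINT x:{-\<tau>..0}. LINT s:{0..T + x}|\<mu>. G (s, s - x))"
      unfolding set_lebesgue_integral_def scaleR_conv_of_real of_real_eq_id id_apply
      by (subst integral_mult_right_zero[symmetric], intro Bochner_Integration.integral_cong refl)
         (auto simp: k_def h_def R_def indicator_def)
    finally show ?thesis unfolding lhs .
  qed
qed

section \<open>Taylor expansion\<close>

lemma has_antiderivative_UNIV:
  fixes U :: "real \<Rightarrow> real"
  assumes "continuous_on UNIV U"
  shows "\<exists>G. \<forall>t. (G has_real_derivative U t) (at t)"
proof -
  obtain G where "\<And>t. (G has_vector_derivative U t) (at t)"
    using einterval_antiderivative[of "-\<infinity>" "\<infinity>" U] assms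
    by (auto simp: continuous_on_eq_continuous_at)
  then show ?thesis by (auto simp: has_real_derivative_iff_has_vector_derivative)
qed

lemma LBINT_FTC:
  fixes U G :: "real \<Rightarrow> real"
  assumes "continuous_on UNIV U" "\<And>t. (G has_real_derivative U t) (at t)" "a \<le> b"
  shows "(LBINT t:{a..b}. U t) = G b - G a"
proof -
  have "(\<integral>x. U x * indicator {a..b} x \<partial>lborel) = G b - G a"
    by (rule integral_FTC_Icc_real) (use assms in \<open>auto simp: continuous_on_eq_continuous_at\<close>)
  then show ?thesis by (simp add: set_lebesgue_integral_def mult.commute)
qed

text \<open>
  With an antiderivative \<open>G\<close> of \<open>U\<close>, the average is a difference of the difference quotients of \<open>G\<close> at
  \<open>T\<close> and at \<open>0\<close>.
\<close>

lemma increment_average_tendsto: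
  fixes U :: "real \<Rightarrow> real" and e :: "nat \<Rightarrow> real"
  assumes U: "continuous_on UNIV U" and e: "filterlim e (at_right 0) sequentially" and "0 \<le> T"
  shows "(\<lambda>n. (LBINT t:{0..T}. U (t + e n) - U t) / e n) \<longlonglongrightarrow> U T - U 0"
proof -
  obtain G where G: "\<And>t. (G has_real_derivative U t) (at t)" using has_antiderivative_UNIV[OF U] by blast
  have shift: "((\<lambda>x. G (x + h)) has_real_derivative U (t + h)) (at t)" for t h
    using G[of "t + h"] by (subst (asm) DERIV_shift) simp
  have Uh: "continuous_on UNIV (\<lambda>t. U (t + h))" for h
    by (intro continuous_on_compose2[OF U] continuous_intros) auto
  have int: "(LBINT t:{0..T}. U (t + h) - U t) = (G (T + h) - G h) - (G T - G 0)" for h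
    using LBINT_FTC[OF Uh shift \<open>0 \<le> T\<close>] LBINT_FTC[OF U G \<open>0 \<le> T\<close>]
    by (subst set_integral_diff) (auto intro!: set_integrable_continuous_Icc U Uh)
  have eq: "(LBINT t:{0..T}. U (t + h) - U t) / h = (G (T + h) - G T) / h - (G (0 + h) - G 0) / h" for h
    unfolding int by (simp add: diff_divide_distrib)
  have lim: "((\<lambda>h. (G (t + h) - G t) / h) \<longlongrightarrow> U t) (at_right 0)" for t
    using G[of t] unfolding DERIV_def by (rule filterlim_mono) (auto simp: at_le)
  show ?thesis
    unfolding eq by (intro tendsto_diff filterlim_compose[OF lim e])
qed

text \<open>
  On a compact square the Lagrange remainder is controlled by the modulus of uniform
  continuity of the second derivative. A Taylor expansion in the second variable follows by exchanging the
  arguments.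
\<close>

lemma uniform_second_order_Taylor:
  fixes g g1 g2 :: "real \<times> real \<Rightarrow> real"
  assumes d1: "\<And>a b. ((\<lambda>u. g (u, b)) has_real_derivative g1 (a, b)) (at a)"
    and d2: "\<And>a b. ((\<lambda>u. g1 (u, b)) has_real_derivative g2 (a, b)) (at a)"
    and cont: "continuous_on UNIV g2" and \<eta>: "0 < \<eta>"
  shows "\<exists>\<delta>>0. \<forall>a\<in>{-B..B}. \<forall>a'\<in>{-B..B}. \<forall>b\<in>{-B..B}. \<bar>a' - a\<bar> < \<delta> \<longrightarrow>
    \<bar>g (a', b) - g (a, b) - g1 (a, b) * (a' - a) - 1/2 * g2 (a, b) * (a' - a)\<^sup>2\<bar> \<le> \<eta> * (a' - a)\<^sup>2"
proof -
  have "uniformly_continuous_on ({-B..B} \<times> {-B..B}) g2"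
    by (intro compact_uniformly_continuous compact_Times compact_Icc continuous_on_subset[OF cont]) auto
  then obtain \<delta> where \<delta>: "\<delta> > 0" "\<And>p q. p \<in> {-B..B} \<times> {-B..B} \<Longrightarrow> q \<in> {-B..B} \<times> {-B..B} \<Longrightarrow>
      dist q p < \<delta> \<Longrightarrow> dist (g2 q) (g2 p) < 2 * \<eta>"
    using \<eta> unfolding uniformly_continuous_on_def by (metis mult_pos_pos zero_less_numeral)
  have "\<bar>g (a', b) - g (a, b) - g1 (a, b) * (a' - a) - 1/2 * g2 (a, b) * (a' - a)\<^sup>2\<bar> \<le> \<eta> * (a' - a)\<^sup>2"
    if *: "a \<in> {-B..B}" "a' \<in> {-B..B}" "b \<in> {-B..B}" "\<bar>a' - a\<bar> < \<delta>" for a a' b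
  proof (cases "a' = a")
    case False
    define D where "D m = (if m = 0 then (\<lambda>u. g (u, b)) else if m = 1 then (\<lambda>u. g1 (u, b)) else (\<lambda>u. g2 (u, b)))" for m :: nat
    have D: "D 0 = (\<lambda>u. g (u, b))" "D (Suc 0) = (\<lambda>u. g1 (u, b))" "D 2 = (\<lambda>u. g2 (u, b))"
      by (auto simp: D_def)
    have "\<forall>m t. m < (2::nat) \<and> -B \<le> t \<and> t \<le> B \<longrightarrow> DERIV (D m) t :> D (Suc m) t"
      using d1 d2 by (auto simp: D_def less_2_cases_iff)
    from Taylor[of 2 D "\<lambda>u. g (u, b)", OF _ D(1) this, of a a'] * False
    obtain \<xi> where \<xi>: "if a' < a then a' < \<xi> \<and> \<xi> < a else a < \<xi> \<and> \<xi> < a'"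
      and eq: "g (a', b) = g (a, b) + g1 (a, b) * (a' - a) + g2 (\<xi>, b) / 2 * (a' - a)\<^sup>2"
      by (auto simp: D D(3)[unfolded numeral_2_eq_2] numeral_2_eq_2)
    have "dist (g2 (\<xi>, b)) (g2 (a, b)) < 2 * \<eta>"
      using * \<xi> by (intro \<delta>(2)) (auto simp: dist_prod_def dist_real_def split: if_splits)
    then have "\<bar>(g2 (\<xi>, b) - g2 (a, b)) / 2\<bar> \<le> \<eta>" by (simp add: dist_real_def)
    then have "\<bar>(g2 (\<xi>, b) - g2 (a, b)) / 2\<bar> * (a' - a)\<^sup>2 \<le> \<eta> * (a' - a)\<^sup>2"
      by (intro mult_right_mono) auto
    moreover have "g (a', b) - g (a, b) - g1 (a, b) * (a' - a) - 1/2 * g2 (a, b) * (a' - a)\<^sup>2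
        = (g2 (\<xi>, b) - g2 (a, b)) / 2 * (a' - a)\<^sup>2"
      unfolding eq by (simp add: field_simps)
    ultimately show ?thesis by (simp only: abs_mult) simp
  qed simp
  with \<delta>(1) show ?thesis by blast
qed

lemma C1_derivs:
  assumes "C1 f"
  shows "((\<lambda>u. f (u, b)) has_real_derivative \<partial>\<^sub>1 f (a, b)) (at a)"
    and "((\<lambda>v. f (a, v)) has_real_derivative \<partial>\<^sub>2 f (a, b)) (at b)"
    and "continuous_on UNIV (\<partial>\<^sub>1 f)" "continuous_on UNIV (\<partial>\<^sub>2 f)"
  using assms unfolding C1_def partial1_def partial2_def
  by (auto simp: DERIV_deriv_iff_real_differentiable)

text \<open>
  Continuous partial derivatives imply total differentiability.
\<close>

lemma C1_continuous:
  assumes "C1 f"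
  shows "continuous_on UNIV f"
proof -
  have "((\<lambda>(x, y). f (x, y)) has_derivative
      (\<lambda>(tx, ty). (\<lambda>h. h * \<partial>\<^sub>1 f (a, b)) tx + blinfun_apply (blinfun_mult_right (\<partial>\<^sub>2 f (a, b))) ty)) (at (a, b) within UNIV \<times> UNIV)"
    for a b
  proof (rule has_derivative_partialsI)
    show "((\<lambda>x. f (x, b)) has_derivative (\<lambda>h. h * \<partial>\<^sub>1 f (a, b))) (at a)"
      using C1_derivs(1)[OF assms, of b a] by (simp add: has_field_derivative_def mult.commute[of _ "\<partial>\<^sub>1 f (a, b)"])
    show "((\<lambda>y. f (x, y)) has_derivative blinfun_apply (blinfun_mult_right (\<partial>\<^sub>2 f (x, y)))) (at y)" for x y
      using C1_derivs(2)[OF assms, of x y] by (simp add: has_field_derivative_def)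
    show "continuous (at (a, b) within UNIV \<times> UNIV) (\<lambda>(x, y). blinfun_mult_right (\<partial>\<^sub>2 f (x, y)))"
      using C1_derivs(4)[OF assms] unfolding split_beta prod.collapse
      by (auto simp: continuous_on_eq_continuous_at intro!: bounded_linear.continuous[OF bounded_linear_blinfun_mult_right])
  qed (use assms in auto)
  then have "isCont f p" for p
    by (cases p) (auto dest!: has_derivative_continuous)
  then show ?thesis by (simp add: continuous_on_eq_continuous_at)
qed

lemma Taylor_under_LBINT:
  fixes A A0 A1 A2 :: "real \<Rightarrow> real"
  assumes cont: "continuous_on UNIV A" "continuous_on UNIV A0" "continuous_on UNIV A1" "continuous_on UNIV A2"
    and "a \<le> b"
    and le: "\<And>t. t \<in> {a..b} \<Longrightarrow> \<bar>A t - A0 t - A1 t * d - 1/2 * A2 t * d\<^sup>2\<bar> \<le> \<eta> * d\<^sup>2"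
  shows "\<bar>(LBINT t:{a..b}. A t) - (LBINT t:{a..b}. A0 t) - (LBINT t:{a..b}. A1 t) * d
      - 1/2 * (LBINT t:{a..b}. A2 t) * d\<^sup>2\<bar> \<le> \<eta> * (b - a) * d\<^sup>2"
proof -
  note si = set_integrable_continuous_Icc
  have "(LBINT t:{a..b}. A t - A0 t - A1 t * d - 1/2 * A2 t * d\<^sup>2) =
    (LBINT t:{a..b}. A t) - (LBINT t:{a..b}. A0 t) - (LBINT t:{a..b}. A1 t) * d - 1/2 * (LBINT t:{a..b}. A2 t) * d\<^sup>2"
    by (subst set_integral_diff; (intro si continuous_intros cont)?)+ simp
  moreover have "\<bar>LBINT t:{a..b}. A t - A0 t - A1 t * d - 1/2 * A2 t * d\<^sup>2\<bar> \<le> \<eta> * d\<^sup>2 * (b - a)"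
    by (rule abs_LBINT_le[OF le \<open>a \<le> b\<close>])
  ultimately show ?thesis by (simp add: mult_ac)
qed

text \<open>
  In the applications \<open>L n y\<close> is a function of the path at \<open>y + e n\<close>, \<open>K y\<close> is its value at \<open>y\<close>, and \<open>K1\<close> and \<open>K2\<close> are
  its first and second derivatives. After division by \<open>e n\<close>, the remainder is at most \<open>\<eta>\<close> times the regularised
  quadratic variation, which stays bounded, and the second order term converges by
  \<open>integral_square_increments_tendsto\<close>.
\<close>

lemma forward_expansion_tendsto:
  fixes w V K K1 K2 :: "real \<Rightarrow> real" and L :: "nat \<Rightarrow> real \<Rightarrow> real" and e :: "nat \<Rightarrow> real"
  assumes w: "continuous_on UNIV w"
    and V: "\<And>x y. x \<le> y \<Longrightarrow> V x \<le> V y" "continuous_on UNIV V" "V 0 = 0"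
    and e: "\<And>n. 0 < e n" and c: "0 \<le> c"
    and lim: "\<And>t. t \<in> {0..c} \<Longrightarrow> (\<lambda>n. 1 / e n * (LBINT s:{0..t}. (w (s + e n) - w s)\<^sup>2)) \<longlonglongrightarrow> V t"
    and cont: "\<And>n. continuous_on {0..c} (L n)" "continuous_on {0..c} K" "continuous_on {0..c} K1"
      "continuous_on {0..c} K2"
    and Taylor: "\<And>\<eta>. 0 < \<eta> \<Longrightarrow> \<forall>\<^sub>F n in sequentially. \<forall>y\<in>{0..c}.
      \<bar>L n y - K y - K1 y * (w (y + e n) - w y) - 1/2 * K2 y * (w (y + e n) - w y)\<^sup>2\<bar>
        \<le> \<eta> * (w (y + e n) - w y)\<^sup>2"
  shows "(\<lambda>n. (LBINT y:{0..c}. L n y - K y) / e n - (LBINT y:{0..c}. K1 y * ((w (y + e n) - w y) / e n)))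
    \<longlonglongrightarrow> 1/2 * (LINT y:{0..c}|interval_measure V. K2 y)"
proof -
  let ?\<Delta> = "\<lambda>n y. w (y + e n) - w y"
  have \<Delta>: "continuous_on {0..c} (?\<Delta> n)" for n
    by (intro continuous_intros continuous_on_compose2[OF w]) auto
  note si = borel_integrable_atLeastAtMost'
  let ?q = "\<lambda>n. LBINT y:{0..c}. K2 y * ((?\<Delta> n y)\<^sup>2 / e n)"
  let ?d = "\<lambda>n. (LBINT y:{0..c}. L n y - K y) / e n - (LBINT y:{0..c}. K1 y * (?\<Delta> n y / e n))"
  let ?S = "\<lambda>n. 1 / e n * (LBINT y:{0..c}. (?\<Delta> n y)\<^sup>2)"
  have q: "?q \<longlonglongrightarrow> (LINT y:{0..c}|interval_measure V. K2 y)"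
    by (rule integral_square_increments_tendsto[OF w V e c lim cont(4)])
  have S: "?S \<longlonglongrightarrow> V c" using lim[of c] c by simp
  have en: "e n \<noteq> 0" for n using e[of n] by simp
  have "(\<lambda>n. ?d n - 1/2 * ?q n) \<longlonglongrightarrow> 0"
  proof (rule tendstoI)
    fix r :: real assume r: "0 < r"
    have Vc: "0 \<le> V c" using V(1)[OF c] V(3) by simp
    define \<eta> where "\<eta> = r / (V c + 1)"
    have \<eta>: "0 < \<eta>" "\<eta> * (V c + 1) = r" using r Vc by (auto simp: \<eta>_def field_simps add_nonneg_eq_0_iff)
    have "\<forall>\<^sub>F n in sequentially. ?S n < V c + 1" by (rule order_tendstoD(2)[OF S]) simp
    with Taylor[OF \<eta>(1)] show "\<forall>\<^sub>F n in sequentially. dist (?d n - 1/2 * ?q n) 0 < r"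
    proof eventually_elim
      case (elim n)
      let ?R = "\<lambda>y. (L n y - K y - K1 y * ?\<Delta> n y - 1/2 * K2 y * (?\<Delta> n y)\<^sup>2) / e n"
      have R: "continuous_on {0..c} ?R" by (intro continuous_intros cont \<Delta>) (auto simp: en)
      have "?d n - 1/2 * ?q n = (LBINT y:{0..c}. (L n y - K y) / e n - K1 y * (?\<Delta> n y / e n) - 1/2 * (K2 y * ((?\<Delta> n y)\<^sup>2 / e n)))"
        using en[of n]
        by (subst set_integral_diff set_integral_diff; (intro si continuous_intros cont \<Delta>)?; simp?)+
      also have "\<dots> = (LBINT y:{0..c}. ?R y)"
        using en[of n] by (intro arg_cong[where f="\<lambda>h. set_lebesgue_integral lborel {0..c} h"] ext) (simp add: field_simps)
      finally have eq: "?d n - 1/2 * ?q n = (LBINT y:{0..c}. ?R y)" .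
      have "\<bar>LBINT y:{0..c}. ?R y\<bar> \<le> (LBINT y:{0..c}. \<bar>?R y\<bar>)"
        using set_integral_norm_bound[OF si[OF R]] by simp
      also have "\<dots> \<le> (LBINT y:{0..c}. \<eta> * ((?\<Delta> n y)\<^sup>2 / e n))"
      proof (rule set_integral_mono)
        show "set_integrable lborel {0..c} (\<lambda>y. \<bar>?R y\<bar>)" by (intro si continuous_intros R)
        show "set_integrable lborel {0..c} (\<lambda>y. \<eta> * ((?\<Delta> n y)\<^sup>2 / e n))"
          by (intro si continuous_intros \<Delta>) (auto simp: en)
        show "\<bar>?R y\<bar> \<le> \<eta> * ((?\<Delta> n y)\<^sup>2 / e n)" if "y \<in> {0..c}" for y
          using elim(1)[rule_format, OF that] e[of n] by (simp add: abs_divide divide_right_mono)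
      qed
      also have "\<dots> = \<eta> * ?S n" by simp
      also have "\<dots> < \<eta> * (V c + 1)" using elim(2) \<eta>(1) by (intro mult_strict_left_mono) auto
      finally show ?case unfolding eq \<eta>(2) by simp
    qed
  qed
  from tendsto_add[OF this tendsto_mult[OF tendsto_const[of "1/2"] q]]
  show ?thesis by simp
qed

section \<open>The delay formula along one path\<close>

text \<open>
  One path of the extended process: constant on either side of \<open>[0,T]\<close> and started at 0.
\<close>

locale delay_path =
  fixes w :: "real \<Rightarrow> real" and T \<tau> :: real and f :: "real \<times> real \<Rightarrow> real"
  assumes w: "continuous_on UNIV w"
    and clamp: "\<And>t. w t = w (max 0 (min t T))"
    and w0: "w 0 = 0"
    and \<tau>: "0 < \<tau>" "\<tau> \<le> T"
    and C2: "C2 f"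
begin

lemma w_nonpos: "t \<le> 0 \<Longrightarrow> w t = 0"
proof -
  assume "t \<le> 0"
  then have "max 0 (min t T) = 0" by auto
  with clamp[of t] w0 show "w t = 0" by metis
qed

lemma w_bounded: "\<exists>B. \<forall>t. \<bar>w t\<bar> \<le> B"
proof -
  have "bounded (w ` {0..T})"
    by (intro compact_imp_bounded compact_continuous_image continuous_on_subset[OF w]) auto
  then obtain B where "\<forall>x\<in>w ` {0..T}. norm x \<le> B" unfolding bounded_iff by blast
  then have B: "\<And>t. t \<in> {0..T} \<Longrightarrow> \<bar>w t\<bar> \<le> B" by simp
  have "\<bar>w t\<bar> \<le> B" for t
  proof -
    have "\<bar>w (max 0 (min t T))\<bar> \<le> B" using \<tau> by (intro B) auto
    then show ?thesis by (metis clamp)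
  qed
  then show ?thesis by blast
qed

lemma w_uniform:
  assumes "0 < \<delta>"
  shows "\<exists>h>0. \<forall>s s'. \<bar>s' - s\<bar> < h \<longrightarrow> \<bar>w s' - w s\<bar> < \<delta>"
proof -
  have "uniformly_continuous_on {0..T} w"
    by (intro compact_uniformly_continuous continuous_on_subset[OF w]) auto
  then obtain h where h: "h > 0" "\<And>s s'. s \<in> {0..T} \<Longrightarrow> s' \<in> {0..T} \<Longrightarrow> dist s' s < h \<Longrightarrow> dist (w s') (w s) < \<delta>"
    using assms unfolding uniformly_continuous_on_def by metis
  have "\<bar>w s' - w s\<bar> < \<delta>" if "\<bar>s' - s\<bar> < h" for s s'
  proof -
    have "\<bar>max 0 (min s' T) - max 0 (min s T)\<bar> \<le> \<bar>s' - s\<bar>" by (auto simp: max_def min_def)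
    then have "dist (w (max 0 (min s' T))) (w (max 0 (min s T))) < \<delta>"
      using that \<tau> by (intro h(2)) (auto simp: dist_real_def)
    then show ?thesis unfolding dist_real_def by (metis clamp)
  qed
  with h(1) show ?thesis by blast
qed

lemma f_deriv:
  "((\<lambda>u. f (u, b)) has_real_derivative \<partial>\<^sub>1 f (a, b)) (at a)"
  "((\<lambda>v. f (a, v)) has_real_derivative \<partial>\<^sub>2 f (a, b)) (at b)"
  "((\<lambda>u. \<partial>\<^sub>1 f (u, b)) has_real_derivative \<partial>\<^sub>1 (\<partial>\<^sub>1 f) (a, b)) (at a)"
  "((\<lambda>v. \<partial>\<^sub>2 f (a, v)) has_real_derivative \<partial>\<^sub>2 (\<partial>\<^sub>2 f) (a, b)) (at b)"
  using C2 by (auto simp: C2_def intro!: C1_derivs)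

lemma f_cont:
  "continuous_on UNIV f" "continuous_on UNIV (\<partial>\<^sub>1 f)" "continuous_on UNIV (\<partial>\<^sub>2 f)"
  "continuous_on UNIV (\<partial>\<^sub>1 (\<partial>\<^sub>1 f))" "continuous_on UNIV (\<partial>\<^sub>2 (\<partial>\<^sub>2 f))"
  using C2 by (auto simp: C2_def intro!: C1_continuous C1_derivs)

lemma continuous_on_path_pair:
  fixes g :: "real \<times> real \<Rightarrow> real" and a b :: "'c::topological_space \<Rightarrow> real"
  assumes "continuous_on UNIV g" "continuous_on S a" "continuous_on S b"
  shows "continuous_on S (\<lambda>p. g (w (a p), w (b p)))"
  by (intro continuous_on_compose2[OF assms(1)] continuous_on_compose2[OF w] continuous_intros assms) auto

lemmas f_path = f_cont[THEN continuous_on_path_pair]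

lemma w_increment:
  assumes e: "filterlim e (at_right 0) sequentially" and "0 < \<delta>"
  shows "\<forall>\<^sub>F n in sequentially. \<forall>s. \<bar>w (s + e n) - w s\<bar> < \<delta>"
proof -
  obtain h where h: "h > 0" "\<And>s s'. \<bar>s' - s\<bar> < h \<Longrightarrow> \<bar>w s' - w s\<bar> < \<delta>"
    using w_uniform[OF \<open>0 < \<delta>\<close>] by blast
  have "e \<longlonglongrightarrow> 0" using e by (simp add: filterlim_at)
  then have "\<forall>\<^sub>F n in sequentially. \<bar>e n\<bar> < h"
    using tendstoD[OF _ h(1)] by (fastforce simp: dist_real_def)
  then show ?thesis by eventually_elim (auto intro: h(2))
qed

text \<open>
  Uniform continuity of \<open>f\<close> on the compact range of the path, combined with uniform continuity of
  the path.
\<close>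

lemma f_increment:
  assumes e: "filterlim e (at_right 0) sequentially" and "0 < \<rho>"
  shows "\<forall>\<^sub>F n in sequentially. \<forall>s r. \<bar>f (w (s + e n), w r) - f (w s, w r)\<bar> \<le> \<rho> \<and>
    \<bar>f (w r, w (s + e n)) - f (w r, w s)\<bar> \<le> \<rho>"
proof -
  obtain B where B: "\<And>t. \<bar>w t\<bar> \<le> B" using w_bounded by blast
  then have B': "w t \<in> {-B..B}" for t using abs_le_iff[of "w t" B] by force
  have "uniformly_continuous_on ({-B..B} \<times> {-B..B}) f"
    by (intro compact_uniformly_continuous compact_Times compact_Icc continuous_on_subset[OF f_cont(1)]) auto
  then obtain \<delta> where \<delta>: "\<delta> > 0" "\<And>p q. p \<in> {-B..B} \<times> {-B..B} \<Longrightarrow> q \<in> {-B..B} \<times> {-B..B} \<Longrightarrow>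
      dist q p < \<delta> \<Longrightarrow> dist (f q) (f p) < \<rho>"
    using \<open>0 < \<rho>\<close> unfolding uniformly_continuous_on_def by metis
  show ?thesis
    using w_increment[OF e \<delta>(1)]
  proof eventually_elim
    case (elim n)
    have "dist (f (w (s + e n), w r)) (f (w s, w r)) < \<rho>" "dist (f (w r, w (s + e n))) (f (w r, w s)) < \<rho>" for s r
      by (rule \<delta>(2); use elim B' in \<open>simp add: dist_prod_def dist_real_def\<close>)+
    then show ?case unfolding dist_real_def by (meson less_imp_le)
  qed
qed

text \<open>
  The functional whose increments are expanded. It is defined with \<open>x \<in> [-\<tau>, 0]\<close> for all \<open>t\<close>; for \<open>t < \<tau>\<close> the
  window reaches into negative times, where the path is 0.
\<close>

definition window_integral :: "real \<Rightarrow> real" where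
  "window_integral t = (LBINT x:{-\<tau>..0}. f (w (t + x), w (t - \<tau>)))"

text \<open>
  With \<open>h = 0\<close> and \<open>g = \<partial>\<^sub>1 f\<close> this is the integrand of the first forward integral. The shift \<open>h\<close> acts only on
  the path at \<open>y\<close>, not on the window, so that \<open>head_integral f h y - head_integral f 0 y\<close> can be expanded in the single
  increment \<open>w (y + h) - w y\<close>.
\<close>

definition head_integral :: "(real \<times> real \<Rightarrow> real) \<Rightarrow> real \<Rightarrow> real \<Rightarrow> real" where
  "head_integral g h y = (LBINT t:{y..min (y + \<tau>) T}. g (w (y + h), w (t - \<tau>)))"

text \<open>
  The same for the second argument: \<open>h = 0\<close> and \<open>g = \<partial>\<^sub>2 f\<close> give the integrand of the second forward integral.
\<close>

definition tail_integral :: "(real \<times> real \<Rightarrow> real) \<Rightarrow> real \<Rightarrow> real \<Rightarrow> real" where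
  "tail_integral g h y = (LBINT x:{-\<tau>..0}. g (w (y + x + \<tau>), w (y + h)))"

lemma continuous_on_LBINT_path:
  fixes g a b :: "real \<times> real \<Rightarrow> real" and \<alpha> \<beta> :: "real \<Rightarrow> real"
  assumes g: "continuous_on UNIV g" and a: "continuous_on UNIV a" "continuous_on UNIV b"
    and "continuous_on S \<alpha>" "continuous_on S \<beta>" "\<And>y. y \<in> S \<Longrightarrow> \<alpha> y \<le> \<beta> y"
  shows "continuous_on S (\<lambda>y. LBINT t:{\<alpha> y..\<beta> y}. g (w (a (y, t)), w (b (y, t))))"
  by (rule continuous_on_LBINT_param[where \<phi>="\<lambda>p. g (w (a p), w (b p))"])
     (rule continuous_on_path_pair[OF g a] assms(4-6) | assumption)+

lemma head_integral_cont: "continuous_on UNIV g \<Longrightarrow> continuous_on {0..T} (head_integral g h)"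
  unfolding head_integral_def
  by (rule continuous_on_LBINT_path[where a="\<lambda>p. fst p + h" and b="\<lambda>p. snd p - \<tau>", simplified])
     (use \<tau> in \<open>auto intro!: continuous_intros\<close>)

lemma tail_integral_cont: "continuous_on UNIV g \<Longrightarrow> continuous_on S (tail_integral g h)"
  unfolding tail_integral_def
  by (rule continuous_on_LBINT_path[where a="\<lambda>p. fst p + snd p + \<tau>" and b="\<lambda>p. fst p + h", simplified])
     (use \<tau> in \<open>auto intro!: continuous_intros\<close>)

lemma head_integral_Taylor:
  assumes e: "filterlim e (at_right 0) sequentially" and \<eta>: "0 < \<eta>"
  shows "\<forall>\<^sub>F n in sequentially. \<forall>y\<in>{0..T}.
      \<bar>head_integral f (e n) y - head_integral f 0 y - head_integral (\<partial>\<^sub>1 f) 0 y * (w (y + e n) - w y)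
        - 1/2 * head_integral (\<partial>\<^sub>1 (\<partial>\<^sub>1 f)) 0 y * (w (y + e n) - w y)\<^sup>2\<bar> \<le> \<eta> * (w (y + e n) - w y)\<^sup>2"
proof -
  obtain B where B: "\<And>t. \<bar>w t\<bar> \<le> B" using w_bounded by blast
  then have B': "w t \<in> {-B..B}" for t using abs_le_iff[of "w t" B] by force
  have "0 < \<eta> / \<tau>" using \<eta> \<tau> by simp
  from uniform_second_order_Taylor[of f "\<partial>\<^sub>1 f" "\<partial>\<^sub>1 (\<partial>\<^sub>1 f)", OF f_deriv(1,3) f_cont(4) this, of B]
  obtain \<delta> where \<delta>: "\<delta> > 0" "\<And>a a' b. a \<in> {-B..B} \<Longrightarrow> a' \<in> {-B..B} \<Longrightarrow> b \<in> {-B..B} \<Longrightarrow> \<bar>a' - a\<bar> < \<delta> \<Longrightarrow>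
     \<bar>f (a', b) - f (a, b) - \<partial>\<^sub>1 f (a, b) * (a' - a) - 1/2 * \<partial>\<^sub>1 (\<partial>\<^sub>1 f) (a, b) * (a' - a)\<^sup>2\<bar> \<le> \<eta> / \<tau> * (a' - a)\<^sup>2"
    by blast
  show ?thesis
    using w_increment[OF e \<delta>(1)]
  proof eventually_elim
    case (elim n)
    show ?case
    proof
      fix y assume y: "y \<in> {0..T}"
      let ?\<Delta> = "w (y + e n) - w y"
      have "\<bar>head_integral f (e n) y - head_integral f 0 y - head_integral (\<partial>\<^sub>1 f) 0 y * ?\<Delta> - 1/2 * head_integral (\<partial>\<^sub>1 (\<partial>\<^sub>1 f)) 0 y * ?\<Delta>\<^sup>2\<bar>
        \<le> \<eta> / \<tau> * (min (y + \<tau>) T - y) * ?\<Delta>\<^sup>2"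
        unfolding head_integral_def add_0_right
        by (rule Taylor_under_LBINT)
           (use y \<tau> elim B' in \<open>auto intro!: f_path continuous_intros \<delta>(2)[simplified]\<close>)
      also have "\<dots> \<le> \<eta> / \<tau> * \<tau> * ?\<Delta>\<^sup>2"
        using \<eta> \<tau> y by (intro mult_right_mono mult_left_mono) auto
      finally show "\<bar>head_integral f (e n) y - head_integral f 0 y - head_integral (\<partial>\<^sub>1 f) 0 y * ?\<Delta> - 1/2 * head_integral (\<partial>\<^sub>1 (\<partial>\<^sub>1 f)) 0 y * ?\<Delta>\<^sup>2\<bar>
        \<le> \<eta> * ?\<Delta>\<^sup>2" using \<tau> by simp
    qed
  qed
qed

lemma tail_integral_Taylor:
  assumes e: "filterlim e (at_right 0) sequentially" and \<eta>: "0 < \<eta>"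
  shows "\<forall>\<^sub>F n in sequentially. \<forall>y\<in>S.
      \<bar>tail_integral f (e n) y - tail_integral f 0 y - tail_integral (\<partial>\<^sub>2 f) 0 y * (w (y + e n) - w y)
        - 1/2 * tail_integral (\<partial>\<^sub>2 (\<partial>\<^sub>2 f)) 0 y * (w (y + e n) - w y)\<^sup>2\<bar> \<le> \<eta> * (w (y + e n) - w y)\<^sup>2"
proof -
  obtain B where B: "\<And>t. \<bar>w t\<bar> \<le> B" using w_bounded by blast
  then have B': "w t \<in> {-B..B}" for t using abs_le_iff[of "w t" B] by force
  have "0 < \<eta> / \<tau>" using \<eta> \<tau> by simp
  moreover have "continuous_on UNIV (\<lambda>p. \<partial>\<^sub>2 (\<partial>\<^sub>2 f) (snd p, fst p))"
    by (intro continuous_on_compose2[OF f_cont(5)] continuous_intros) auto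
  ultimately obtain \<delta> where \<delta>: "\<delta> > 0" "\<And>a a' b. a \<in> {-B..B} \<Longrightarrow> a' \<in> {-B..B} \<Longrightarrow> b \<in> {-B..B} \<Longrightarrow> \<bar>a' - a\<bar> < \<delta> \<Longrightarrow>
     \<bar>f (b, a') - f (b, a) - \<partial>\<^sub>2 f (b, a) * (a' - a) - 1/2 * \<partial>\<^sub>2 (\<partial>\<^sub>2 f) (b, a) * (a' - a)\<^sup>2\<bar> \<le> \<eta> / \<tau> * (a' - a)\<^sup>2"
    using uniform_second_order_Taylor[of "\<lambda>p. f (snd p, fst p)" "\<lambda>p. \<partial>\<^sub>2 f (snd p, fst p)"
      "\<lambda>p. \<partial>\<^sub>2 (\<partial>\<^sub>2 f) (snd p, fst p)" "\<eta> / \<tau>" B] f_deriv(2,4)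
    unfolding fst_conv snd_conv by blast
  show ?thesis
    using w_increment[OF e \<delta>(1)]
  proof eventually_elim
    case (elim n)
    show ?case
    proof
      fix y assume y: "y \<in> S"
      let ?\<Delta> = "w (y + e n) - w y"
      have "\<bar>tail_integral f (e n) y - tail_integral f 0 y - tail_integral (\<partial>\<^sub>2 f) 0 y * ?\<Delta> - 1/2 * tail_integral (\<partial>\<^sub>2 (\<partial>\<^sub>2 f)) 0 y * ?\<Delta>\<^sup>2\<bar>
        \<le> \<eta> / \<tau> * (0 - - \<tau>) * ?\<Delta>\<^sup>2"
        unfolding tail_integral_def add_0_right
        by (rule Taylor_under_LBINT)
           (use \<tau> elim B' in \<open>auto intro!: f_path continuous_intros \<delta>(2)[simplified]\<close>)
      then show "\<bar>tail_integral f (e n) y - tail_integral f 0 y - tail_integral (\<partial>\<^sub>2 f) 0 y * ?\<Delta> - 1/2 * tail_integral (\<partial>\<^sub>2 (\<partial>\<^sub>2 f)) 0 y * ?\<Delta>\<^sup>2\<bar>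
        \<le> \<eta> * ?\<Delta>\<^sup>2" using \<tau> by simp
    qed
  qed
qed

lemma window_integral_cont: "continuous_on S window_integral"
  unfolding window_integral_def
  by (rule continuous_on_LBINT_path[where a="\<lambda>p. fst p + snd p" and b="\<lambda>p. fst p - \<tau>", simplified])
     (use \<tau> in \<open>auto intro!: continuous_intros f_cont\<close>)

lemma window_integral_0: "window_integral 0 = \<tau> * f (0, 0)"
proof -
  have "window_integral 0 = (LBINT x:{-\<tau>..0}. f (0, 0))"
    unfolding window_integral_def using \<tau> by (intro set_lebesgue_integral_cong) (auto simp: w_nonpos)
  also have "\<dots> = \<tau> * f (0, 0)"
    using \<tau> by (simp add: set_lebesgue_integral_def)
  finally show ?thesis .
qed

text \<open>
  The integrated increment of the window integral is the sum of the increments in either argument, up to \<open>\<rho>\<epsilon>\<close> where \<open>\<rho>\<close> is the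
  oscillation of \<open>f\<close>. There are three errors: times \<open>s \<in> [-\<epsilon>, 0]\<close>, at which the path has
  already left 0 at \<open>s + \<epsilon>\<close>; the two ends of the window, when it is moved back from \<open>t + \<epsilon>\<close> to \<open>t\<close> for the increment in the second argument; and times
  \<open>t \<in> [\<tau> - \<epsilon>, \<tau>]\<close>, which the second forward integral leaves out. Each of them integrates a
  function bounded by \<open>\<rho>\<close> over a planar set whose area is of order \<open>\<epsilon>\<close>.
\<close>

lemma window_integral_increment:
  assumes \<epsilon>: "0 < \<epsilon>" and \<rho>: "\<And>s r. \<bar>f (w (s + \<epsilon>), w r) - f (w s, w r)\<bar> \<le> \<rho>"
    "\<And>s r. \<bar>f (w r, w (s + \<epsilon>)) - f (w r, w s)\<bar> \<le> \<rho>"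
  shows "\<bar>(LBINT t:{0..T}. window_integral (t + \<epsilon>) - window_integral t) - (LBINT y:{0..T}. head_integral f \<epsilon> y - head_integral f 0 y)
    - (LBINT y:{0..T - \<tau>}. tail_integral f \<epsilon> y - tail_integral f 0 y)\<bar> \<le> 4 * \<rho> * T * \<epsilon>"
proof -
  have \<rho>0: "0 \<le> \<rho>" using \<rho>(1)[of 0 0] by linarith
  define F where "F p = f (w (fst p + \<epsilon>), w (snd p - \<tau>)) - f (w (fst p), w (snd p - \<tau>))" for p
  define G where "G s t = f (w s, w (t - \<tau> + \<epsilon>)) - f (w s, w (t - \<tau>))" for s t
  \<comment> \<open>\<open>D1 + D2\<close> is the increment of the window integral; \<open>E1\<close> cuts the window of \<open>D1\<close> at time 0, \<open>E2\<close> moves the window of \<open>D2\<close> back by \<open>\<epsilon>\<close>.\<close>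
  define E1 where "E1 t = (LBINT s:{max 0 (t - \<tau>)..t}. F (s, t))" for t
  define D1 where "D1 t = (LBINT s:{t - \<tau>..t}. F (s, t))" for t
  define D2 where "D2 t = (LBINT s:{t - \<tau> + \<epsilon>..t + \<epsilon>}. G s t)" for t
  define E2 where "E2 t = (LBINT s:{t - \<tau>..t}. G s t)" for t
  have Fc: "continuous_on UNIV F"
    unfolding F_def by (intro continuous_intros f_path)
  have Gc: "continuous_on UNIV (\<lambda>p. G (snd p) (fst p))"
    unfolding G_def by (intro continuous_intros f_path)
  have Fb: "\<bar>F p\<bar> \<le> \<rho>" for p unfolding F_def by (rule \<rho>(1))
  have Gb: "\<bar>G s t\<bar> \<le> \<rho>" for s t unfolding G_def by (rule \<rho>(2))
  have Ft: "continuous_on UNIV (\<lambda>s. F (s, t))" for t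
    by (intro continuous_on_compose2[OF Fc] continuous_intros) auto
  have Gt: "continuous_on UNIV (\<lambda>s. G s t)" for t
    unfolding G_def by (intro continuous_intros f_path)
  note si = set_integrable_continuous_Icc
  have D1c: "continuous_on {0..T} D1" and E1c: "continuous_on {0..T} E1"
    unfolding D1_def E1_def using \<tau>
    by (auto intro!: continuous_on_LBINT_param[where \<phi>="\<lambda>p. F (snd p, fst p)", simplified] continuous_intros
        continuous_on_compose2[OF Fc])
  have D2c: "continuous_on {0..T} D2" and E2c: "continuous_on S E2" for S
    unfolding D2_def E2_def using \<tau>
    by (auto intro!: continuous_on_LBINT_param[OF Gc, simplified] continuous_intros)
  have window_integral_split: "window_integral (t + \<epsilon>) - window_integral t = D1 t + D2 t" for t
  proof -
    have p: "continuous_on UNIV (\<lambda>s. f (w (s + a), w b))" for a b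
      by (intro continuous_intros f_path)
    have U1: "window_integral (t + \<epsilon>) = (LBINT s:{t - \<tau>..t}. f (w (s + \<epsilon>), w (t - \<tau> + \<epsilon>)))"
      unfolding window_integral_def using LBINT_translate[of "-\<tau>" 0 "\<lambda>s. f (w (s + \<epsilon>), w (t - \<tau> + \<epsilon>))" t]
      by (simp add: algebra_simps)
    have U2: "window_integral t = (LBINT s:{t - \<tau>..t}. f (w s, w (t - \<tau>)))"
      unfolding window_integral_def using LBINT_translate[of "-\<tau>" 0 "\<lambda>s. f (w s, w (t - \<tau>))" t]
      by (simp add: algebra_simps)
    have D2: "D2 t = (LBINT s:{t - \<tau>..t}. G (s + \<epsilon>) t)"
      unfolding D2_def by (rule LBINT_translate[symmetric])
    show ?thesis
      unfolding U1 U2 D1_def D2 F_def G_def fst_conv snd_conv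
      using p[of 0] by (simp add: si p)
  qed
  have err1: "\<bar>D1 t - E1 t\<bar> \<le> \<rho> * \<epsilon>" if "t \<in> {0..T}" for t
  proof -
    have i: "integrable lborel (\<lambda>s. indicator {a..b} s *\<^sub>R F (s, t))" for a b
      by (rule si[unfolded set_integrable_def]) (rule Ft)
    have "D1 t - E1 t = (\<integral>s. indicator {t - \<tau>..t} s *\<^sub>R F (s, t) - indicator {max 0 (t - \<tau>)..t} s *\<^sub>R F (s, t) \<partial>lborel)"
      unfolding D1_def E1_def set_lebesgue_integral_def
      by (rule Bochner_Integration.integral_diff[symmetric]) (rule i)+
    moreover have "\<bar>\<dots>\<bar> \<le> \<rho> * (0 - (- \<epsilon>))"
    proof (rule abs_integral_le_indicator)
      show "\<bar>indicator {t - \<tau>..t} s *\<^sub>R F (s, t) - indicator {max 0 (t - \<tau>)..t} s *\<^sub>R F (s, t)\<bar> \<le> \<rho> * indicator {-\<epsilon>..0} s" for s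
        using Fb[of "(s, t)"] \<rho>0 that by (auto simp: indicator_def F_def w_nonpos)
    qed (use \<epsilon> in simp)
    ultimately show ?thesis by simp
  qed
  have err2: "\<bar>D2 t - E2 t\<bar> \<le> 2 * \<rho> * \<epsilon>" for t
  proof -
    let ?A = "{t - \<tau>..t - \<tau> + \<epsilon>}" and ?B = "{t..t + \<epsilon>}"
    let ?d = "\<lambda>s. indicator {t - \<tau> + \<epsilon>..t + \<epsilon>} s *\<^sub>R G s t - indicator {t - \<tau>..t} s *\<^sub>R G s t"
    have i: "integrable lborel (\<lambda>s. indicator {a..b} s *\<^sub>R G s t)" for a b
      by (rule si[unfolded set_integrable_def]) (rule Gt)
    have ii: "integrable lborel (\<lambda>s. \<rho> * indicator {a..b} s :: real)" for a b :: real
      by (intro integrable_mult_right integrable_real_indicator) (auto simp: emeasure_lborel_Icc_eq)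
    have d: "D2 t - E2 t = (\<integral>s. ?d s \<partial>lborel)"
      unfolding D2_def E2_def set_lebesgue_integral_def
      by (rule Bochner_Integration.integral_diff[symmetric]) (rule i)+
    have "\<bar>D2 t - E2 t\<bar> \<le> (\<integral>s. \<bar>?d s\<bar> \<partial>lborel)" unfolding d by (rule integral_abs_bound)
    also have "\<dots> \<le> (\<integral>s. \<rho> * indicator ?A s + \<rho> * indicator ?B s \<partial>lborel)"
    proof (rule integral_mono)
      show "\<bar>?d s\<bar> \<le> \<rho> * indicator ?A s + \<rho> * indicator ?B s" for s
        using Gb[of s t] \<rho>0 \<epsilon> \<tau> by (auto simp: indicator_def)
      show "integrable lborel (\<lambda>s. \<bar>?d s\<bar>)"
        by (rule integrable_abs[OF Bochner_Integration.integrable_diff[OF i i]])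
      show "integrable lborel (\<lambda>s. \<rho> * indicator ?A s + \<rho> * indicator ?B s)"
        by (rule Bochner_Integration.integrable_add[OF ii ii])
    qed
    also have "\<dots> = 2 * \<rho> * \<epsilon>"
      using \<epsilon> by (subst Bochner_Integration.integral_add[OF ii ii]) simp
    finally show ?thesis .
  qed
  have E1: "(LBINT t:{0..T}. E1 t) = (LBINT y:{0..T}. head_integral f \<epsilon> y - head_integral f 0 y)"
  proof -
    have "(LBINT t:{0..T}. E1 t) = (LBINT s:{0..T}. LBINT t:{s..min (s + \<tau>) T}. F (s, t))"
      unfolding E1_def by (rule strip_Fubini(1)[OF _ _ _ Fc Fb \<tau>(1), symmetric]) (simp_all add: lborel.sigma_finite_measure_axioms emeasure_lborel_Icc_eq)
    also have "\<dots> = (LBINT y:{0..T}. head_integral f \<epsilon> y - head_integral f 0 y)"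
      unfolding head_integral_def F_def fst_conv snd_conv
      by (subst set_integral_diff) (auto intro!: si f_path continuous_intros)
    finally show ?thesis .
  qed
  have E2: "\<bar>(LBINT t:{0..T}. E2 t) - (LBINT y:{0..T - \<tau>}. tail_integral f \<epsilon> y - tail_integral f 0 y)\<bar> \<le> \<rho> * T * \<epsilon>"
  proof -
    have E2_eq: "E2 (y + \<tau>) = tail_integral f \<epsilon> y - tail_integral f 0 y" for y
    proof -
      have "E2 (y + \<tau>) = (LBINT x:{-\<tau>..0}. G (x + (y + \<tau>)) (y + \<tau>))"
        unfolding E2_def using LBINT_translate[of "-\<tau>" 0 "\<lambda>s. G s (y + \<tau>)" "y + \<tau>"] by simp
      also have "\<dots> = tail_integral f \<epsilon> y - tail_integral f 0 y"
        unfolding tail_integral_def G_def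
        by (subst set_integral_diff(2)[symmetric])
           (auto intro!: si f_path continuous_intros simp: algebra_simps)
      finally show ?thesis .
    qed
    have tail_integral_int: "(LBINT y:{0..T - \<tau>}. tail_integral f \<epsilon> y - tail_integral f 0 y) = (LBINT t:{\<tau>..T}. E2 t)"
      using LBINT_translate[of 0 "T - \<tau>" E2 \<tau>] by (simp add: E2_eq)
    have E2b: "\<bar>E2 t\<bar> \<le> \<rho> * \<tau>" for t
      unfolding E2_def using abs_LBINT_le[of "t - \<tau>" t "\<lambda>s. G s t" \<rho>] Gb \<tau> by simp
    have E2z: "E2 t = 0" if "t \<le> \<tau> - \<epsilon>" for t
      using that \<epsilon> unfolding E2_def G_def by (simp add: w_nonpos set_lebesgue_integral_def)
    have "(LBINT t:{0..T}. E2 t) - (LBINT t:{\<tau>..T}. E2 t) =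
        (\<integral>t. indicator {0..T} t *\<^sub>R E2 t - indicator {\<tau>..T} t *\<^sub>R E2 t \<partial>lborel)"
      unfolding set_lebesgue_integral_def
      by (rule Bochner_Integration.integral_diff[symmetric]) (rule si[unfolded set_integrable_def], rule E2c)+
    moreover have "\<bar>\<dots>\<bar> \<le> (\<rho> * \<tau>) * (\<tau> - (\<tau> - \<epsilon>))"
    proof (rule abs_integral_le_indicator)
      show "\<bar>indicator {0..T} t *\<^sub>R E2 t - indicator {\<tau>..T} t *\<^sub>R E2 t\<bar> \<le> (\<rho> * \<tau>) * indicator {\<tau> - \<epsilon>..\<tau>} t" for t
        using E2b[of t] E2z[of t] \<rho>0 \<tau> by (auto simp: indicator_def)
    qed (use \<epsilon> in simp)
    moreover have "\<rho> * \<tau> * \<epsilon> \<le> \<rho> * T * \<epsilon>" using \<rho>0 \<tau> \<epsilon> by (intro mult_right_mono mult_left_mono) auto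
    ultimately show ?thesis unfolding tail_integral_int by simp
  qed
  note si' = borel_integrable_atLeastAtMost'
  have "(LBINT t:{0..T}. window_integral (t + \<epsilon>) - window_integral t) = (LBINT t:{0..T}. (E1 t + E2 t) + ((D1 t - E1 t) + (D2 t - E2 t)))"
    by (simp add: window_integral_split)
  also have "\<dots> = (LBINT t:{0..T}. E1 t) + (LBINT t:{0..T}. E2 t) + (LBINT t:{0..T}. (D1 t - E1 t) + (D2 t - E2 t))"
    by (subst set_integral_add; (intro si' continuous_intros D1c D2c E1c E2c)?)+ simp
  finally have "(LBINT t:{0..T}. window_integral (t + \<epsilon>) - window_integral t) - (LBINT t:{0..T}. E1 t) - (LBINT t:{0..T}. E2 t) =
    (LBINT t:{0..T}. (D1 t - E1 t) + (D2 t - E2 t))" by simp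
  moreover have "\<bar>LBINT t:{0..T}. (D1 t - E1 t) + (D2 t - E2 t)\<bar> \<le> (3 * \<rho> * \<epsilon>) * (T - 0)"
  proof (rule abs_LBINT_le)
    show "\<bar>(D1 t - E1 t) + (D2 t - E2 t)\<bar> \<le> 3 * \<rho> * \<epsilon>" if "t \<in> {0..T}" for t
    proof -
      have "3 * \<rho> * \<epsilon> = \<rho> * \<epsilon> + 2 * \<rho> * \<epsilon>" by simp
      then show ?thesis using err1[OF that] err2[of t] by linarith
    qed
  qed (use \<tau> in simp)
  ultimately show ?thesis using E2 unfolding E1 by (simp add: algebra_simps)
qed

theorem forward_sums_tendsto:
  fixes V :: "real \<Rightarrow> real" and e :: "nat \<Rightarrow> real"
  assumes V: "\<And>x y. x \<le> y \<Longrightarrow> V x \<le> V y" "continuous_on UNIV V" "V 0 = 0"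
    and e: "\<And>n. 0 < e n" "filterlim e (at_right 0) sequentially"
    and lim: "\<And>t. t \<in> {0..T} \<Longrightarrow> (\<lambda>n. 1 / e n * (LBINT s:{0..t}. (w (s + e n) - w s)\<^sup>2)) \<longlonglongrightarrow> V t"
  shows "(\<lambda>n. (LBINT y:{0..T}. head_integral (\<partial>\<^sub>1 f) 0 y * ((w (y + e n) - w y) / e n))
      + (LBINT y:{0..T - \<tau>}. tail_integral (\<partial>\<^sub>2 f) 0 y * ((w (y + e n) - w y) / e n)))
    \<longlonglongrightarrow> window_integral T - window_integral 0 - 1/2 * (LINT y:{0..T}|interval_measure V. head_integral (\<partial>\<^sub>1 (\<partial>\<^sub>1 f)) 0 y)
      - 1/2 * (LINT y:{0..T - \<tau>}|interval_measure V. tail_integral (\<partial>\<^sub>2 (\<partial>\<^sub>2 f)) 0 y)"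
proof -
  let ?I1 = "\<lambda>n. LBINT y:{0..T}. head_integral f (e n) y - head_integral f 0 y"
  let ?I2 = "\<lambda>n. LBINT y:{0..T - \<tau>}. tail_integral f (e n) y - tail_integral f 0 y"
  let ?J = "\<lambda>n. LBINT t:{0..T}. window_integral (t + e n) - window_integral t"
  let ?A1 = "\<lambda>n. LBINT y:{0..T}. head_integral (\<partial>\<^sub>1 f) 0 y * ((w (y + e n) - w y) / e n)"
  let ?A2 = "\<lambda>n. LBINT y:{0..T - \<tau>}. tail_integral (\<partial>\<^sub>2 f) 0 y * ((w (y + e n) - w y) / e n)"
  have T: "0 \<le> T" and T\<tau>: "0 \<le> T - \<tau>" using \<tau> by simp_all
  have lim': "(\<lambda>n. 1 / e n * (LBINT s:{0..t}. (w (s + e n) - w s)\<^sup>2)) \<longlonglongrightarrow> V t" if "t \<in> {0..T - \<tau>}" for t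
    using that \<tau> by (intro lim) auto
  have 1: "(\<lambda>n. ?I1 n / e n - ?A1 n) \<longlonglongrightarrow> 1/2 * (LINT y:{0..T}|interval_measure V. head_integral (\<partial>\<^sub>1 (\<partial>\<^sub>1 f)) 0 y)"
    by (rule forward_expansion_tendsto[OF w V e(1) T lim]) (assumption | rule head_integral_cont f_cont head_integral_Taylor[OF e(2)])+
  have 2: "(\<lambda>n. ?I2 n / e n - ?A2 n) \<longlonglongrightarrow> 1/2 * (LINT y:{0..T - \<tau>}|interval_measure V. tail_integral (\<partial>\<^sub>2 (\<partial>\<^sub>2 f)) 0 y)"
    by (rule forward_expansion_tendsto[OF w V e(1) T\<tau> lim']) (assumption | rule tail_integral_cont f_cont tail_integral_Taylor[OF e(2)])+
  have 3: "(\<lambda>n. ?J n / e n) \<longlonglongrightarrow> window_integral T - window_integral 0"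
    by (rule increment_average_tendsto[OF window_integral_cont e(2) T])
  have 4: "(\<lambda>n. (?J n - ?I1 n - ?I2 n) / e n) \<longlonglongrightarrow> 0"
  proof (rule tendstoI)
    fix r :: real assume r: "0 < r"
    \<comment> \<open>The bound of \<open>window_integral_increment\<close> is then \<open>r / 2\<close>.\<close>
    define \<rho> where "\<rho> = r / (8 * T)"
    have \<rho>: "0 < \<rho>" "4 * \<rho> * T < r" using r \<tau> by (auto simp: \<rho>_def)
    show "\<forall>\<^sub>F n in sequentially. dist ((?J n - ?I1 n - ?I2 n) / e n) 0 < r"
      using f_increment[OF e(2) \<rho>(1)]
    proof eventually_elim
      case (elim n)
      have "\<bar>?J n - ?I1 n - ?I2 n\<bar> \<le> 4 * \<rho> * T * e n"
        by (rule window_integral_increment[OF e(1)]) (use elim in auto)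
      then have "\<bar>(?J n - ?I1 n - ?I2 n) / e n\<bar> \<le> 4 * \<rho> * T"
        using e(1)[of n] by (simp add: abs_divide pos_divide_le_eq)
      then show ?case using \<rho>(2) by simp
    qed
  qed
  have lim: "(\<lambda>n. ?J n / e n - (?J n - ?I1 n - ?I2 n) / e n - (?I1 n / e n - ?A1 n) - (?I2 n / e n - ?A2 n)) \<longlonglongrightarrow>
    window_integral T - window_integral 0 - 0 - 1/2 * (LINT y:{0..T}|interval_measure V. head_integral (\<partial>\<^sub>1 (\<partial>\<^sub>1 f)) 0 y)
      - 1/2 * (LINT y:{0..T - \<tau>}|interval_measure V. tail_integral (\<partial>\<^sub>2 (\<partial>\<^sub>2 f)) 0 y)"
    by (intro tendsto_diff 1 2 3 4)
  have eq: "?J n / e n - (?J n - ?I1 n - ?I2 n) / e n - (?I1 n / e n - ?A1 n) - (?I2 n / e n - ?A2 n) = ?A1 n + ?A2 n" for n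
    by (simp add: diff_divide_distrib)
  show ?thesis using lim unfolding eq by simp
qed

text \<open>
  By Fubini along the diagonals of the strip.
\<close>

lemma Stieltjes_head_integral:
  assumes V: "\<And>x y. x \<le> y \<Longrightarrow> V x \<le> V y" "continuous_on UNIV V"
    and g: "continuous_on UNIV g"
  shows "(LINT y:{0..T}|interval_measure V. head_integral g 0 y) =
    (LBINT x:{-\<tau>..0}. LINT t:{-x..T}|interval_measure (\<lambda>t. V (t + x)). g (w (t + x), w (t - \<tau>)))"
proof -
  define G where "G p = g (w (fst p), w (snd p - \<tau>))" for p
  have Gc: "continuous_on UNIV G" unfolding G_def by (rule continuous_on_path_pair[OF g]) (intro continuous_intros)+
  obtain B where B: "\<And>t. \<bar>w t\<bar> \<le> B" using w_bounded by blast
  then have B': "w t \<in> {-B..B}" for t using abs_le_iff[of "w t" B] by force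
  have "bounded (g ` ({-B..B} \<times> {-B..B}))"
    by (intro compact_imp_bounded compact_continuous_image compact_Times compact_Icc continuous_on_subset[OF g]) auto
  then obtain C where "\<And>p. p \<in> {-B..B} \<times> {-B..B} \<Longrightarrow> \<bar>g p\<bar> \<le> C" unfolding bounded_iff by auto
  then have C: "\<bar>G p\<bar> \<le> C" for p using B' unfolding G_def by blast
  have rc: "continuous (at_right a) V" for a
    using V(2) by (simp add: continuous_on_eq_continuous_within continuous_at_imp_continuous_within)
  have fin: "emeasure (interval_measure V) {0..T} < \<infinity>"
    using emeasure_interval_measure_Icc[of 0 T V, OF _ V] \<tau> by simp
  have "(LINT y:{0..T}|interval_measure V. head_integral g 0 y) = (LBINT x:{-\<tau>..0}. LINT s:{0..T + x}|interval_measure V. G (s, s - x))"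
    using strip_Fubini(2)[OF sigma_finite_interval_measure[OF V(1) rc] _ fin Gc C \<tau>(1)]
    by (simp add: head_integral_def G_def)
  also have "\<dots> = (LBINT x:{-\<tau>..0}. LINT t:{-x..T}|interval_measure (\<lambda>t. V (t + x)). g (w (t + x), w (t - \<tau>)))"
  proof (intro set_lebesgue_integral_cong allI impI)
    fix x
    have "(\<lambda>t. g (w (t + x), w (t - \<tau>))) \<in> borel_measurable borel"
      by (intro borel_measurable_continuous_onI continuous_on_path_pair[OF g] continuous_intros)
    from LINT_interval_measure_translate[where V=V and x=x, OF V this, of "-x" T]
    show "(LINT s:{0..T + x}|interval_measure V. G (s, s - x)) = (LINT t:{-x..T}|interval_measure (\<lambda>t. V (t + x)). g (w (t + x), w (t - \<tau>)))"
      by (simp add: G_def)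
  qed auto
  finally show ?thesis .
qed

end

text \<open>
  The limits along rational times determine the quadratic variation as a continuous
  nondecreasing function that starts at 0, so that its Stieltjes measure exists.
\<close>

lemma forward_sums_tendsto_path:
  fixes x q :: "real \<Rightarrow> real" and e :: "nat \<Rightarrow> real"
  assumes \<tau>: "0 < \<tau>" "\<tau> \<le> T" and f: "C2 f"
    and x: "continuous_on {0..T} x" "x 0 = 0" and q: "continuous_on {0..T} q"
    and e: "\<And>n. 0 < e n" "filterlim e (at_right 0) sequentially"
  defines "w \<equiv> \<lambda>t. x (max 0 (min t T))" and "v \<equiv> \<lambda>t. q (max 0 (min t T))"
  assumes lim: "\<And>t. t \<in> insert T (\<rat> \<inter> {0..T}) \<Longrightarrow>
      (\<lambda>n. 1 / e n * (LBINT s:{0..t}. (w (s + e n) - w s)\<^sup>2)) \<longlonglongrightarrow> q t"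
  shows "(\<lambda>n. (LBINT y:{0..T}. (LBINT t:{y..min (y + \<tau>) T}. \<partial>\<^sub>1 f (w y, w (t - \<tau>))) * ((w (y + e n) - w y) / e n))
      + (LBINT y:{0..T - \<tau>}. (LBINT x:{-\<tau>..0}. \<partial>\<^sub>2 f (w (y + x + \<tau>), w y)) * ((w (y + e n) - w y) / e n)))
    \<longlonglongrightarrow> (LBINT x:{-\<tau>..0}. f (w (x + T), w (T - \<tau>))) - \<tau> * f (0, 0)
      - 1/2 * (LINT y:{0..T - \<tau>}|interval_measure v. (LBINT z:{-\<tau>..0}. \<partial>\<^sub>2 (\<partial>\<^sub>2 f) (w (y + z + \<tau>), w y)))
      - 1/2 * (LBINT x:{-\<tau>..0}. (LINT t:{-x..T}|interval_measure (\<lambda>t. v (t + x)).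
          \<partial>\<^sub>1 (\<partial>\<^sub>1 f) (w (t + x), w (t - \<tau>))))"
proof -
  have T: "0 \<le> T" using \<tau> by simp
  have w: "continuous_on UNIV w" and v: "continuous_on UNIV v"
    unfolding w_def v_def by (rule continuous_on_clamp[OF x(1) T] continuous_on_clamp[OF q T])+
  interpret delay_path w T \<tau> f
  proof
    show "continuous_on UNIV w" by (rule w)
    show "w t = w (max 0 (min t T))" for t using T by (auto simp: w_def intro!: arg_cong[where f=x])
    show "w 0 = 0" using T x(2) by (simp add: w_def)
  qed (use \<tau> f in auto)
  let ?S = "\<lambda>n t. 1 / e n * (LBINT s:{0..t}. (w (s + e n) - w s)\<^sup>2)"
  have S_mono: "?S n s \<le> ?S n t" if "s \<le> t" for n s t
    by (rule LBINT_square_increments_mono[OF w e(1) that])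
  have lim': "(\<lambda>n. ?S n t) \<longlonglongrightarrow> q t" if "t \<in> {0..T}" for t
    by (rule distribution_functions_tendsto[OF S_mono q lim that])
  have q_mono: "q s \<le> q t" if "s \<in> {0..T}" "t \<in> {0..T}" "s \<le> t" for s t
    by (rule LIMSEQ_le[OF lim'[OF that(1)] lim'[OF that(2)]]) (use S_mono[OF that(3)] in auto)
  have S0: "?S n 0 = 0" for n
    using LBINT_Ioc_eq_Icc[of 0 0 "\<lambda>s. (w (s + e n) - w s)\<^sup>2"] by (simp add: set_lebesgue_integral_def)
  have "(\<lambda>n. ?S n 0) \<longlonglongrightarrow> q 0" using T by (intro lim') simp
  then have q0: "q 0 = 0" unfolding S0 by (simp add: LIMSEQ_const_iff)
  have v_mono: "v s \<le> v t" if "s \<le> t" for s t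
    unfolding v_def using that T by (intro q_mono) auto
  have v0: "v 0 = 0" using T q0 by (simp add: v_def)
  have vlim: "(\<lambda>n. ?S n t) \<longlonglongrightarrow> v t" if "t \<in> {0..T}" for t
    using lim'[OF that] that by (simp add: v_def)
  have "window_integral T = (LBINT x:{-\<tau>..0}. f (w (x + T), w (T - \<tau>)))" by (simp add: window_integral_def add.commute)
  then show ?thesis
    using forward_sums_tendsto[OF v_mono v v0 e vlim] Stieltjes_head_integral[OF v_mono v f_cont(4)]
    unfolding window_integral_0 head_integral_def tail_integral_def by (simp add: algebra_simps)
qed

section \<open>Measurability of the regularised integrals\<close>

text \<open>
  Paths are well behaved only off a null set. Measurability is therefore proved for a modification
  that vanishes there, and transferred to the completion.
\<close>

lemma borel_measurable_completion_AE:
  fixes g h :: "'a \<Rightarrow> real"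
  assumes h: "h \<in> borel_measurable M" and ae: "AE \<omega> in M. g \<omega> = h \<omega>"
  shows "g \<in> borel_measurable (completion M)"
proof (rule measurableI)
  fix A :: "real set" assume A: "A \<in> sets borel"
  have h': "h -` A \<inter> space (completion M) \<in> sets (completion M)"
    using measurable_sets[OF measurable_completion[OF h] A] .
  show "g -` A \<inter> space (completion M) \<in> sets (completion M)"
  proof (rule completion.in_sets_AE[OF _ h'])
    show "AE \<omega> in completion M. \<omega> \<in> h -` A \<inter> space (completion M) \<longleftrightarrow> \<omega> \<in> g -` A \<inter> space (completion M)"
      unfolding AE_completion_iff using ae by eventually_elim auto
  qed auto
qed auto

text \<open>
  A continuous process is the pointwise limit of its discretisations in time.
\<close>

lemma jointly_measurable_continuous_process:
  fixes W :: "real \<Rightarrow> 'a \<Rightarrow> real"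
  assumes W: "\<And>t. W t \<in> borel_measurable M"
    and cont: "\<And>\<omega>. \<omega> \<in> space M \<Longrightarrow> continuous_on UNIV (\<lambda>t. W t \<omega>)"
  shows "(\<lambda>p. W (fst p) (snd p)) \<in> borel_measurable (borel \<Otimes>\<^sub>M M)"
proof (rule borel_measurable_LIMSEQ_real)
  let ?k = "\<lambda>n t. \<lfloor>real (Suc n) * t\<rfloor>"
  show "(\<lambda>p. W (of_int (?k n (fst p)) / real (Suc n)) (snd p)) \<in> borel_measurable (borel \<Otimes>\<^sub>M M)" for n
  proof (rule measurable_compose_countable[where f="\<lambda>i p. W (of_int i / real (Suc n)) (snd p)"])
    show "(\<lambda>p. W (of_int i / real (Suc n)) (snd p)) \<in> borel_measurable (borel \<Otimes>\<^sub>M M)" for i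
      using W by (rule measurable_compose[OF measurable_snd])
    show "(\<lambda>p. ?k n (fst p)) \<in> borel \<Otimes>\<^sub>M M \<rightarrow>\<^sub>M count_space UNIV" by measurable
  qed
  fix p :: "real \<times> 'a" assume "p \<in> space (borel \<Otimes>\<^sub>M M)"
  then have \<omega>: "snd p \<in> space M" by (auto simp: space_pair_measure)
  have "(\<lambda>n. of_int (?k n (fst p)) / real (Suc n)) \<longlonglongrightarrow> fst p"
  proof (rule tendsto_sandwich)
    show "\<forall>\<^sub>F n in sequentially. fst p - 1 / real (Suc n) \<le> of_int (?k n (fst p)) / real (Suc n)"
    proof (intro always_eventually allI)
      fix n
      have "real (Suc n) * fst p - 1 \<le> of_int (?k n (fst p))" by linarith
      then have "(real (Suc n) * fst p - 1) / real (Suc n) \<le> of_int (?k n (fst p)) / real (Suc n)"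
        by (rule divide_right_mono) simp
      then show "fst p - 1 / real (Suc n) \<le> of_int (?k n (fst p)) / real (Suc n)"
        by (simp add: diff_divide_distrib del: of_nat_Suc)
    qed
    show "\<forall>\<^sub>F n in sequentially. of_int (?k n (fst p)) / real (Suc n) \<le> fst p"
    proof (intro always_eventually allI)
      fix n
      have "of_int (?k n (fst p)) / real (Suc n) \<le> (real (Suc n) * fst p) / real (Suc n)"
        by (rule divide_right_mono) auto
      then show "of_int (?k n (fst p)) / real (Suc n) \<le> fst p" by (simp del: of_nat_Suc)
    qed
    show "(\<lambda>n. fst p - 1 / real (Suc n)) \<longlonglongrightarrow> fst p"
      using tendsto_diff[OF tendsto_const[of "fst p"] LIMSEQ_inverse_real_of_nat] by (simp add: inverse_eq_divide)
  qed auto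
  then show "(\<lambda>n. W (of_int (?k n (fst p)) / real (Suc n)) (snd p)) \<longlonglongrightarrow> W (fst p) (snd p)"
    using cont[OF \<omega>] by (intro continuous_on_tendsto_compose[of UNIV "\<lambda>t. W t (snd p)"]) auto
qed

lemma measurable_LBINT_Icc:
  fixes g :: "'b \<Rightarrow> real \<Rightarrow> real"
  assumes [measurable]: "(\<lambda>p. g (fst p) (snd p)) \<in> borel_measurable (N \<Otimes>\<^sub>M borel)"
    "\<alpha> \<in> borel_measurable N" "\<beta> \<in> borel_measurable N"
  shows "(\<lambda>x. LBINT t:{\<alpha> x..\<beta> x}. g x t) \<in> borel_measurable N"
proof -
  have [measurable]: "(\<lambda>p. g (fst p) (snd p)) \<in> borel_measurable (N \<Otimes>\<^sub>M lborel)" by measurable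
  have "(\<lambda>p. if \<alpha> (fst p) \<le> snd p \<and> snd p \<le> \<beta> (fst p) then g (fst p) (snd p) else 0) \<in> borel_measurable (N \<Otimes>\<^sub>M lborel)"
    by measurable
  then have "(\<lambda>x. \<integral>t. (if \<alpha> x \<le> t \<and> t \<le> \<beta> x then g x t else 0) \<partial>lborel) \<in> borel_measurable N"
    by (intro lborel.borel_measurable_lebesgue_integral) (simp add: split_beta)
  also have "(\<lambda>x. \<integral>t. (if \<alpha> x \<le> t \<and> t \<le> \<beta> x then g x t else 0) \<partial>lborel) = (\<lambda>x. LBINT t:{\<alpha> x..\<beta> x}. g x t)"
    unfolding set_lebesgue_integral_def
    by (intro ext Bochner_Integration.integral_cong) (auto simp: indicator_def)
  finally show ?thesis .
qed

lemma forward_approximation_measurable: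
  fixes W :: "real \<Rightarrow> 'a \<Rightarrow> real"
  assumes W: "(\<lambda>p. W (fst p) (snd p)) \<in> borel_measurable (borel \<Otimes>\<^sub>M M)"
    and Y: "(\<lambda>p. Y (snd p) (fst p)) \<in> borel_measurable (M \<Otimes>\<^sub>M borel)"
  shows "(\<lambda>\<omega>. LBINT y:{0..c}. Y y \<omega> * ((W (y + \<epsilon>) \<omega> - W y \<omega>) / \<epsilon>)) \<in> borel_measurable M"
proof (rule measurable_LBINT_Icc)
  have [measurable]: "(\<lambda>x. W (u x) (o' x)) \<in> borel_measurable N"
    if [measurable]: "u \<in> borel_measurable N" "o' \<in> N \<rightarrow>\<^sub>M M" for u o' and N :: "'z measure"
    using measurable_compose[OF _ W, of "\<lambda>x. (u x, o' x)" N] by simp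
  note [measurable] = Y
  show "(\<lambda>p. Y (snd p) (fst p) * ((W (snd p + \<epsilon>) (fst p) - W (snd p) (fst p)) / \<epsilon>)) \<in> borel_measurable (M \<Otimes>\<^sub>M borel)"
    by measurable
qed auto

lemma delay_integrand_measurable:
  fixes W :: "real \<Rightarrow> 'a \<Rightarrow> real" and g :: "real \<times> real \<Rightarrow> real" and a b :: "real \<Rightarrow> real \<Rightarrow> real"
  assumes W: "(\<lambda>p. W (fst p) (snd p)) \<in> borel_measurable (borel \<Otimes>\<^sub>M M)"
    and g: "continuous_on UNIV g"
    and a: "continuous_on UNIV (\<lambda>p. a (fst p) (snd p))" and b: "continuous_on UNIV (\<lambda>p. b (fst p) (snd p))"
    and \<alpha>: "continuous_on UNIV \<alpha>" and \<beta>: "continuous_on UNIV \<beta>"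
  shows "(\<lambda>p. LBINT t:{\<alpha> (snd p)..\<beta> (snd p)}. g (W (a (snd p) t) (fst p), W (b (snd p) t) (fst p)))
    \<in> borel_measurable (M \<Otimes>\<^sub>M borel)"
proof (rule measurable_LBINT_Icc[where g="\<lambda>p t. g (W (a (snd p) t) (fst p), W (b (snd p) t) (fst p))"])
  have W' [measurable]: "(\<lambda>x. W (u x) (o' x)) \<in> borel_measurable N"
    if [measurable]: "u \<in> borel_measurable N" "o' \<in> N \<rightarrow>\<^sub>M M" for u o' and N :: "'z measure"
    using measurable_compose[OF _ W, of "\<lambda>x. (u x, o' x)" N] by simp
  have [measurable]: "\<alpha> \<in> borel_measurable borel" "\<beta> \<in> borel_measurable borel" "g \<in> borel_measurable borel"
    using \<alpha> \<beta> g by (auto intro: borel_measurable_continuous_onI)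
  have comp: "(\<lambda>q. h (snd (fst q)) (snd q)) \<in> borel_measurable ((M \<Otimes>\<^sub>M borel) \<Otimes>\<^sub>M borel)"
    if "continuous_on UNIV (\<lambda>p. h (fst p) (snd p))" for h :: "real \<Rightarrow> real \<Rightarrow> real"
  proof -
    have "(\<lambda>p. h (fst p) (snd p)) \<in> borel_measurable (borel \<Otimes>\<^sub>M borel)"
      using borel_measurable_continuous_onI[OF that] by (simp add: borel_prod)
    from measurable_compose[OF _ this, of "\<lambda>q. (snd (fst q), snd q)" "(M \<Otimes>\<^sub>M borel) \<Otimes>\<^sub>M borel"]
    show ?thesis by simp
  qed
  note [measurable] = comp[OF a] comp[OF b]
  show "(\<lambda>q. g (W (a (snd (fst q)) (snd q)) (fst (fst q)), W (b (snd (fst q)) (snd q)) (fst (fst q))))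
    \<in> borel_measurable ((M \<Otimes>\<^sub>M borel) \<Otimes>\<^sub>M borel)"
    by measurable
  show "(\<lambda>p. \<alpha> (snd p)) \<in> borel_measurable (M \<Otimes>\<^sub>M borel)" "(\<lambda>p. \<beta> (snd p)) \<in> borel_measurable (M \<Otimes>\<^sub>M borel)"
    by measurable
qed

section \<open>The Ito formula with delay\<close>

text \<open>
  Integrability of the two integrands holds for every continuous path, so that the existence of a forward
  integral amounts to convergence in probability of \<open>A\<close> or \<open>B\<close> below. Since \<open>A + B\<close> always converges, to
  \<open>J\<close>, each of them converges as soon as the other does.
\<close>

theorem proposition6p4:
  fixes M :: "'a measure" and X Q :: "real \<Rightarrow> 'a \<Rightarrow> real"
    and f :: "real \<times> real \<Rightarrow> real" and \<tau> T :: real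
  assumes "prob_space M"
    and "0 < \<tau>" and "\<tau> \<le> T"
    and "continuous_process M T X"
    and "quadratic_variation M T X Q"
    and "AE \<omega> in M. X 0 \<omega> = 0"
    and "C2 f"
  shows "let
      W = extend T X;
      V = extend T Q;
      Y1 = (\<lambda>y \<omega>. LBINT t:{y..min (y + \<tau>) T}. \<partial>\<^sub>1 f (W y \<omega>, W (t - \<tau>) \<omega>));
      Y2 = (\<lambda>y \<omega>. LBINT x:{-\<tau>..0}. \<partial>\<^sub>2 f (W (y + x + \<tau>) \<omega>, W y \<omega>))
    in
      (\<exists>I1. forward_integral M T X Y1 T I1) \<or> (\<exists>I2. forward_integral M T X Y2 (T - \<tau>) I2)
      \<longrightarrow>
      (\<exists>I1. forward_integral M T X Y1 T I1) \<and> (\<exists>I2. forward_integral M T X Y2 (T - \<tau>) I2) \<and>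
      (\<forall>I1 I2. forward_integral M T X Y1 T I1 \<longrightarrow> forward_integral M T X Y2 (T - \<tau>) I2 \<longrightarrow>
        (AE \<omega> in M.
          (LBINT x:{-\<tau>..0}. f (W (x + T) \<omega>, W (T - \<tau>) \<omega>)) =
            \<tau> * f (0, 0) + I1 \<omega> + I2 \<omega>
            + 1/2 * (LINT y:{0..T - \<tau>}|interval_measure (\<lambda>y. V y \<omega>).
                (LBINT z:{-\<tau>..0}. \<partial>\<^sub>2 (\<partial>\<^sub>2 f) (W (y + z + \<tau>) \<omega>, W y \<omega>)))
            + 1/2 * (LBINT x:{-\<tau>..0}.
                (LINT t:{-x..T}|interval_measure (\<lambda>t. V (t + x) \<omega>).
                  \<partial>\<^sub>1 (\<partial>\<^sub>1 f) (W (t + x) \<omega>, W (t - \<tau>) \<omega>)))))"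
proof -
  note M = assms(1) and \<tau> = assms(2,3) and f = assms(7)
  have T: "0 \<le> T" using \<tau> by simp
  define W where "W = extend T X"
  define V where "V = extend T Q"
  define Y1 where "Y1 = (\<lambda>y \<omega>. LBINT t:{y..min (y + \<tau>) T}. \<partial>\<^sub>1 f (W y \<omega>, W (t - \<tau>) \<omega>))"
  define Y2 where "Y2 = (\<lambda>y \<omega>. LBINT x:{-\<tau>..0}. \<partial>\<^sub>2 f (W (y + x + \<tau>) \<omega>, W y \<omega>))"
  define A where "A = (\<lambda>\<epsilon> \<omega>. LBINT y:{0..T}. Y1 y \<omega> * ((W (y + \<epsilon>) \<omega> - W y \<omega>) / \<epsilon>))"
  define B where "B = (\<lambda>\<epsilon> \<omega>. LBINT y:{0..T - \<tau>}. Y2 y \<omega> * ((W (y + \<epsilon>) \<omega> - W y \<omega>) / \<epsilon>))"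
  define J where "J = (\<lambda>\<omega>. (LBINT x:{-\<tau>..0}. f (W (x + T) \<omega>, W (T - \<tau>) \<omega>)) - \<tau> * f (0, 0)
      - 1/2 * (LINT y:{0..T - \<tau>}|interval_measure (\<lambda>y. V y \<omega>).
          (LBINT z:{-\<tau>..0}. \<partial>\<^sub>2 (\<partial>\<^sub>2 f) (W (y + z + \<tau>) \<omega>, W y \<omega>)))
      - 1/2 * (LBINT x:{-\<tau>..0}. (LINT t:{-x..T}|interval_measure (\<lambda>t. V (t + x) \<omega>).
          \<partial>\<^sub>1 (\<partial>\<^sub>1 f) (W (t + x) \<omega>, W (t - \<tau>) \<omega>))))"
  define good where "good \<omega> \<longleftrightarrow> continuous_on {0..T} (\<lambda>t. X t \<omega>) \<and> continuous_on {0..T} (\<lambda>t. Q t \<omega>) \<and> X 0 \<omega> = 0" for \<omega>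
  have good: "AE \<omega> in M. good \<omega>"
    using assms(4,5,6) unfolding good_def continuous_process_def quadratic_variation_def by auto
  have df_cont: "continuous_on UNIV (\<partial>\<^sub>1 f)" "continuous_on UNIV (\<partial>\<^sub>2 f)"
    using f by (auto simp: C2_def intro: C1_derivs)
  have path: "delay_path (\<lambda>t. W t \<omega>) T \<tau> f" if "good \<omega>" for \<omega>
  proof
    show "continuous_on UNIV (\<lambda>t. W t \<omega>)"
      using that T unfolding W_def extend_def good_def by (intro continuous_on_clamp) auto
    show "W t \<omega> = W (max 0 (min t T)) \<omega>" for t
      using T by (auto simp: W_def extend_def intro!: arg_cong2[where f=X])
    show "W 0 \<omega> = 0" using that T by (simp add: W_def extend_def good_def)
  qed (use \<tau> f in auto)

  (* The approximations coincide almost surely with those of a process that is continuous for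
     every outcome, for which Fubini gives measurability. *)
  obtain N where N: "N \<in> null_sets M" "\<And>\<omega>. \<omega> \<in> space M \<Longrightarrow> \<not> good \<omega> \<Longrightarrow> \<omega> \<in> N"
    using good unfolding eventually_ae_filter by auto
  \<comment> \<open>The modification of the process with continuous paths on the whole space.\<close>
  define W' where "W' t \<omega> = (if \<omega> \<in> N then 0 else W t \<omega>)" for t \<omega>
  have W'_eq: "AE \<omega> in M. \<forall>t. W' t \<omega> = W t \<omega>"
    using AE_not_in[OF N(1)] by eventually_elim (simp add: W'_def)
  have W': "(\<lambda>p. W' (fst p) (snd p)) \<in> borel_measurable (borel \<Otimes>\<^sub>M M)"
  proof (rule jointly_measurable_continuous_process)
    have "X s \<in> borel_measurable M" if "s \<in> {0..T}" for s
      using assms(4) that by (auto simp: continuous_process_def)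
    then have [measurable]: "W t \<in> borel_measurable M" for t using T by (auto simp: W_def extend_def)
    have [measurable]: "N \<in> sets M" using N(1) by auto
    show "W' t \<in> borel_measurable M" for t unfolding W'_def by measurable
    show "continuous_on UNIV (\<lambda>t. W' t \<omega>)" if "\<omega> \<in> space M" for \<omega>
    proof (cases "\<omega> \<in> N")
      case False
      with N(2)[OF that] have "good \<omega>" by blast
      then show ?thesis using delay_path.w[OF path] False by (simp add: W'_def)
    qed (simp add: W'_def)
  qed
  have A_meas: "A \<epsilon> \<in> borel_measurable (completion M)" for \<epsilon>
  proof (rule borel_measurable_completion_AE)
    show "(\<lambda>\<omega>. LBINT y:{0..T}. (LBINT t:{y..min (y + \<tau>) T}. \<partial>\<^sub>1 f (W' y \<omega>, W' (t - \<tau>) \<omega>)) *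
        ((W' (y + \<epsilon>) \<omega> - W' y \<omega>) / \<epsilon>)) \<in> borel_measurable M"
      by (intro forward_approximation_measurable[OF W'] delay_integrand_measurable[OF W' df_cont(1), where a="\<lambda>y t. y" and b="\<lambda>y t. t - \<tau>" and \<alpha>="\<lambda>y. y" and \<beta>="\<lambda>y. min (y + \<tau>) T"] continuous_intros)
    show "AE \<omega> in M. A \<epsilon> \<omega> = (LBINT y:{0..T}. (LBINT t:{y..min (y + \<tau>) T}. \<partial>\<^sub>1 f (W' y \<omega>, W' (t - \<tau>) \<omega>)) *
        ((W' (y + \<epsilon>) \<omega> - W' y \<omega>) / \<epsilon>))"
      using W'_eq by eventually_elim (simp add: A_def Y1_def)
  qed
  have B_meas: "B \<epsilon> \<in> borel_measurable (completion M)" for \<epsilon>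
  proof (rule borel_measurable_completion_AE)
    show "(\<lambda>\<omega>. LBINT y:{0..T - \<tau>}. (LBINT x:{-\<tau>..0}. \<partial>\<^sub>2 f (W' (y + x + \<tau>) \<omega>, W' y \<omega>)) *
        ((W' (y + \<epsilon>) \<omega> - W' y \<omega>) / \<epsilon>)) \<in> borel_measurable M"
      by (intro forward_approximation_measurable[OF W'] delay_integrand_measurable[OF W' df_cont(2), where a="\<lambda>y x. y + x + \<tau>" and b="\<lambda>y x. y" and \<alpha>="\<lambda>y. -\<tau>" and \<beta>="\<lambda>y. 0"] continuous_intros)
    show "AE \<omega> in M. B \<epsilon> \<omega> = (LBINT y:{0..T - \<tau>}. (LBINT x:{-\<tau>..0}. \<partial>\<^sub>2 f (W' (y + x + \<tau>) \<omega>, W' y \<omega>)) *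
        ((W' (y + \<epsilon>) \<omega> - W' y \<omega>) / \<epsilon>))"
      using W'_eq by eventually_elim (simp add: B_def Y2_def)
  qed

  (* Rational times and T determine the quadratic variation of a good path. *)
  have "\<exists>J'. (AE \<omega> in M. J' \<omega> = J \<omega>) \<and> tendsto_in_prob M (\<lambda>\<epsilon> \<omega>. A \<epsilon> \<omega> + B \<epsilon> \<omega>) J' (at_right 0)"
  proof (rule tendsto_in_prob_pathwiseI[OF M])
    show "countable (insert T (\<rat> \<inter> {0..T}))" by (auto intro: countable_rat countable_Int1)
    show "tendsto_in_prob M (\<lambda>\<epsilon> \<omega>. 1 / \<epsilon> * (LBINT s:{0..t}. (W (s + \<epsilon>) \<omega> - W s \<omega>)\<^sup>2)) (Q t) (at_right 0)"
      if "t \<in> insert T (\<rat> \<inter> {0..T})" for t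
      using assms(5) that T unfolding quadratic_variation_def W_def by auto
    show "(\<lambda>\<omega>. A \<epsilon> \<omega> + B \<epsilon> \<omega>) \<in> borel_measurable (completion M)" for \<epsilon>
      by (intro borel_measurable_add A_meas B_meas)
    show "AE \<omega> in M. \<forall>e. (\<forall>n. 0 < e n) \<longrightarrow> filterlim e (at_right 0) sequentially \<longrightarrow>
        (\<forall>t\<in>insert T (\<rat> \<inter> {0..T}). (\<lambda>n. 1 / e n * (LBINT s:{0..t}. (W (s + e n) \<omega> - W s \<omega>)\<^sup>2)) \<longlonglongrightarrow> Q t \<omega>) \<longrightarrow>
        (\<lambda>n. A (e n) \<omega> + B (e n) \<omega>) \<longlonglongrightarrow> J \<omega>"
      using good
    proof (eventually_elim, intro allI impI)
      fix \<omega> and e :: "nat \<Rightarrow> real"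
      assume g: "good \<omega>" and e: "\<forall>n. 0 < e n" "filterlim e (at_right 0) sequentially"
        and lim: "\<forall>t\<in>insert T (\<rat> \<inter> {0..T}). (\<lambda>n. 1 / e n * (LBINT s:{0..t}. (W (s + e n) \<omega> - W s \<omega>)\<^sup>2)) \<longlonglongrightarrow> Q t \<omega>"
      show "(\<lambda>n. A (e n) \<omega> + B (e n) \<omega>) \<longlonglongrightarrow> J \<omega>"
        unfolding A_def B_def J_def Y1_def Y2_def W_def V_def extend_def
        by (rule forward_sums_tendsto_path[OF \<tau> f])
           (use g e lim[unfolded W_def extend_def] in \<open>auto simp: good_def\<close>)
    qed
  qed
  then obtain J' where J': "AE \<omega> in M. J' \<omega> = J \<omega>"
    and AB: "tendsto_in_prob M (\<lambda>\<epsilon> \<omega>. A \<epsilon> \<omega> + B \<epsilon> \<omega>) J' (at_right 0)" by blast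

  have F1: "forward_integral M T X Y1 T I \<longleftrightarrow> tendsto_in_prob M A I (at_right 0)" for I
  proof -
    have "AE \<omega> in M. set_integrable lborel {0..T} (\<lambda>y. Y1 y \<omega>)"
      using good
    proof eventually_elim
      case (elim \<omega>)
      have "continuous_on {0..T} (\<lambda>y. Y1 y \<omega>)"
        using delay_path.head_integral_cont[OF path[OF elim] df_cont(1), of 0]
        by (simp add: delay_path.head_integral_def[OF path[OF elim]] Y1_def)
      then show ?case by (rule borel_integrable_atLeastAtMost')
    qed
    then show ?thesis unfolding forward_integral_def A_def W_def by simp
  qed
  have F2: "forward_integral M T X Y2 (T - \<tau>) I \<longleftrightarrow> tendsto_in_prob M B I (at_right 0)" for I
  proof -
    have "AE \<omega> in M. set_integrable lborel {0..T - \<tau>} (\<lambda>y. Y2 y \<omega>)"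
      using good
    proof eventually_elim
      case (elim \<omega>)
      have "continuous_on {0..T - \<tau>} (\<lambda>y. Y2 y \<omega>)"
        using delay_path.tail_integral_cont[OF path[OF elim] df_cont(2), of "{0..T - \<tau>}" 0]
        by (simp add: delay_path.tail_integral_def[OF path[OF elim]] Y2_def)
      then show ?case by (rule borel_integrable_atLeastAtMost')
    qed
    then show ?thesis unfolding forward_integral_def B_def W_def by simp
  qed
  have 12: "tendsto_in_prob M B (\<lambda>\<omega>. J' \<omega> - I \<omega>) (at_right 0)" if "tendsto_in_prob M A I (at_right 0)" for I
    by (rule tendsto_in_prob_diff[OF M AB that]) (auto simp: B_meas)
  have 21: "tendsto_in_prob M A (\<lambda>\<omega>. J' \<omega> - I \<omega>) (at_right 0)" if "tendsto_in_prob M B I (at_right 0)" for I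
    by (rule tendsto_in_prob_diff[OF M AB that]) (auto simp: A_meas)
  have eq: "AE \<omega> in M. J \<omega> = I1 \<omega> + I2 \<omega>"
    if "tendsto_in_prob M A I1 (at_right 0)" "tendsto_in_prob M B I2 (at_right 0)" for I1 I2
    using tendsto_in_prob_unique[OF M trivial_limit_at_right_real 12[OF that(1)] that(2)] J'
    by eventually_elim auto
  have "(\<exists>I1. forward_integral M T X Y1 T I1) \<or> (\<exists>I2. forward_integral M T X Y2 (T - \<tau>) I2)
      \<longrightarrow>
      (\<exists>I1. forward_integral M T X Y1 T I1) \<and> (\<exists>I2. forward_integral M T X Y2 (T - \<tau>) I2) \<and>
      (\<forall>I1 I2. forward_integral M T X Y1 T I1 \<longrightarrow> forward_integral M T X Y2 (T - \<tau>) I2 \<longrightarrow>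
        (AE \<omega> in M. J \<omega> = I1 \<omega> + I2 \<omega>))"
    unfolding F1 F2 using 12 21 eq by blast
  moreover have "J \<omega> = I1 \<omega> + I2 \<omega> \<longleftrightarrow> (LBINT x:{-\<tau>..0}. f (W (x + T) \<omega>, W (T - \<tau>) \<omega>)) =
            \<tau> * f (0, 0) + I1 \<omega> + I2 \<omega>
            + 1/2 * (LINT y:{0..T - \<tau>}|interval_measure (\<lambda>y. V y \<omega>).
                (LBINT z:{-\<tau>..0}. \<partial>\<^sub>2 (\<partial>\<^sub>2 f) (W (y + z + \<tau>) \<omega>, W y \<omega>)))
            + 1/2 * (LBINT x:{-\<tau>..0}.
                (LINT t:{-x..T}|interval_measure (\<lambda>t. V (t + x) \<omega>).
                  \<partial>\<^sub>1 (\<partial>\<^sub>1 f) (W (t + x) \<omega>, W (t - \<tau>) \<omega>)))" for I1 I2 \<omega>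
    unfolding J_def by (simp only: algebra_simps)
  ultimately show ?thesis
    unfolding Let_def W_def[symmetric] V_def[symmetric] Y1_def[symmetric] Y2_def[symmetric] by simp
qed

end
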